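(* There exists $r\in(0,1/\pi)$ such that for every $\lambda>0$ and for any Lipschitz function $f:\mathbb{C}^n\to\mathbb{R}$ with compact support in $\{z\in\mathbb{C}^n : \|z\|<\lambda r\}$ and with Lipschitz constant $\operatorname{Lip}(f)<\pi\lambda r/4$, the set $$A_{\lambda,f}=\{[z,t]\in\mathbb{H}^n : \|z\|\le\lambda/\pi,\ 2\pi|t-f(z)|\le\lambda^2\}\cup A_\lambda^2$$ satisfies $\mathcal{L}^{2n+1}(A_{\lambda,f})=\mathcal{L}^{2n+1}(A_\lambda)$ and $\operatorname{diam}A_{\lambda,f}=\operatorname{diam}A_\lambda$.
   Context: Let $n\ge 1$. The Heisenberg group is $\mathbb{H}^n=\mathbb{C}^n\times\mathbb{R}\approx\mathbb{R}^{2n+1}$ with points $[z,t]$, $z=(z_1,\dots,z_n)$, $z_j=x_j+iy_j$, and group law $[z,t]\cdot[z',t']=[z+z',\,t+t'+2\operatorname{Im} z\overline{z}']$, where $\operatorname{Im} z\overline z'=\sum_j\operatorname{Im} z_j\overline{z}'_j$. Put $X_j=\partial_{x_j}+2y_j\partial_t$, $Y_j=\partial_{y_j}-2x_j\partial_t$. A curve is horizontal if it is absolutely continuous and its tangent vector lies a.e. in $\operatorname{span}\{X_j,Y_j\}_{j}$. Fix the left-invariant Riemannian metric making $(X_1,\dots,X_n,Y_1,\dots,Y_n,\partial_t)$ orthonormal; the Carnot-Carathéodory distance $d(p,q)$ is the infimum of the Riemannian lengths of horizontal curves joining $p$ to $q$. Diameters are with respect to $d$; $\overline B(p,s)$ is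 the closed $d$-ball; $0=[0,0]$; $\mathcal{L}^{2n+1}$ is Lebesgue measure on $\mathbb{R}^{2n+1}$; $\|z\|=(\sum_j|z_j|^2)^{1/2}$ (also used for the Lipschitz constant). Let $\rho:[0,\pi]\to[0,1]$, $\rho(\varphi)=\frac{\sin\varphi}{\varphi}$ for $\varphi>0$, $\rho(0)=1$ (a decreasing bijection); let $g(\varphi)=\frac{2\varphi-\sin(2\varphi)}{2\varphi^2}$ for $0<\varphi\le\pi$, $g(0)=0$; let $h=g\circ\rho^{-1}:[0,1]\to\mathbb{R}$ and, for $\mu>0$ and $s\in[0,\mu]$, $h_\mu(s)=\mu^2h(s/\mu)$. For $\lambda>0$ set $l_\lambda(s)=\frac{\lambda^2}{2\pi}$ if $s\in[0,\lambda/\pi]$ and $l_\lambda(s)=h_{\lambda/2}(s)$ if $s\in[\lambda/\pi,\lambda/2]$, and $A_\lambda=\{[z,t]\in\mathbb{H}^n : 2\|z\|\le\lambda,\ |t|\le l_\lambda(\|z\|)\}$. Finally $A_\lambda^2=\overline B(0,\lambda/2)\cap\{[z,t]\in\mathbb{H}^n : \|z\|\ge\lambda/\pi\}$. *)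

theory Defs
  imports "HOL-Analysis.Analysis"
begin

text \<open>A point \<open>[z,t]\<close> is a pair of \<open>z :: complex^'n\<close> and \<open>t :: real\<close>, with \<open>n = CARD('n)\<close>.  As a
  Euclidean space this is \<open>R^(2n+1)\<close>; the norm on \<^typ>\<open>complex^'n\<close> is the Hermitian one.
  Tangent vectors are identified with elements of the same type: the operators
  \<open>\<partial>/\<partial>x_j\<close>, \<open>\<partial>/\<partial>y_j\<close>, \<open>\<partial>/\<partial>t\<close> correspond to \<open>(axis j 1, 0)\<close>, \<open>(axis j \<i>, 0)\<close>, \<open>(0, 1)\<close>.\<close>

type_synonym 'n heis = "(complex ^ 'n) \<times> real"

definition im_form :: "complex ^ 'n \<Rightarrow> complex ^ 'n \<Rightarrow> real" where
  "im_form z w = (\<Sum>j\<in>UNIV. Im (z $ j * cnj (w $ j)))"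

definition heis_mult :: "'n::finite heis \<Rightarrow> 'n heis \<Rightarrow> 'n heis" where
  "heis_mult p q = (fst p + fst q, snd p + snd q + 2 * im_form (fst p) (fst q))"

definition X_field :: "'n::finite \<Rightarrow> 'n heis \<Rightarrow> 'n heis" where
  "X_field j p = (axis j 1, 2 * Im (fst p $ j))"

definition Y_field :: "'n::finite \<Rightarrow> 'n heis \<Rightarrow> 'n heis" where
  "Y_field j p = (axis j \<i>, - 2 * Re (fst p $ j))"

definition T_vec :: "'n::finite heis" where
  "T_vec = (0, 1)"

definition horizontal_space :: "'n::finite heis \<Rightarrow> 'n heis set" where
  "horizontal_space p = span (range (\<lambda>j. X_field j p) \<union> range (\<lambda>j. Y_field j p))"

text \<open>In the frame \<open>X_j, Y_j, \<partial>/\<partial>t\<close> at \<open>p = [z,t]\<close>, a tangent vector \<open>(v,s)\<close> has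
  coefficients \<open>Re v_j\<close>, \<open>Im v_j\<close> and \<open>s - 2 Im z \<cdot> cnj v\<close>.  The metric is the
  Euclidean inner product of these coefficients; the lemmas below confirm that it
  is the one for which the frame is orthonormal, and that it is left-invariant.\<close>

definition T_coeff :: "'n::finite heis \<Rightarrow> 'n heis \<Rightarrow> real" where
  "T_coeff p u = snd u - 2 * im_form (fst p) (fst u)"

definition riem_inner :: "'n::finite heis \<Rightarrow> 'n heis \<Rightarrow> 'n heis \<Rightarrow> real" where
  "riem_inner p u v =
     (\<Sum>j\<in>UNIV. Re (fst u $ j) * Re (fst v $ j) + Im (fst u $ j) * Im (fst v $ j))
     + T_coeff p u * T_coeff p v"

definition riem_norm :: "'n::finite heis \<Rightarrow> 'n heis \<Rightarrow> real" where
  "riem_norm p u = sqrt (riem_inner p u u)"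

lemma T_coeff_frame [simp]:
  "T_coeff p (X_field j p) = 0" "T_coeff p (Y_field j p) = 0" "T_coeff p T_vec = 1"
proof -
  have "im_form (fst p) (axis j c) = Im (fst p $ j * cnj c)" for c
  proof -
    have "im_form (fst p) (axis j c) = (\<Sum>i\<in>UNIV. if i = j then Im (fst p $ j * cnj c) else 0)"
      unfolding im_form_def by (intro sum.cong) (auto simp: axis_def)
    then show ?thesis by simp
  qed
  then show "T_coeff p (X_field j p) = 0" "T_coeff p (Y_field j p) = 0"
    by (simp_all add: T_coeff_def X_field_def Y_field_def)
  show "T_coeff p T_vec = 1"
    by (simp add: T_coeff_def T_vec_def im_form_def)
qed

lemma frame_orthonormal:
  fixes p :: "'n::finite heis"
  shows
  "riem_inner p (X_field i p) (X_field j p) = (if i = j then 1 else 0)"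
  "riem_inner p (Y_field i p) (Y_field j p) = (if i = j then 1 else 0)"
  "riem_inner p (X_field i p) (Y_field j p) = 0"
  "riem_inner p (X_field i p) T_vec = 0"
  "riem_inner p (Y_field i p) T_vec = 0"
  "riem_inner p T_vec T_vec = 1"
proof -
  have XX: "(\<Sum>k\<in>UNIV. (axis i c :: complex ^ 'n) $ k \<bullet> axis j d $ k) = (if i = j then c \<bullet> d else 0)"
    for i j :: 'n and c d :: complex
    using inner_axis_axis[of i c j d] by (simp add: inner_vec_def)
  have *: "riem_inner p u v = (\<Sum>k\<in>UNIV. fst u $ k \<bullet> fst v $ k) + T_coeff p u * T_coeff p v"
    for u v :: "'n heis"
    by (simp add: riem_inner_def inner_complex_def)
  show "riem_inner p (X_field i p) (X_field j p) = (if i = j then 1 else 0)"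
    "riem_inner p (Y_field i p) (Y_field j p) = (if i = j then 1 else 0)"
    "riem_inner p (X_field i p) (Y_field j p) = 0"
    by (simp_all only: * T_coeff_frame) (simp_all add: X_field_def Y_field_def XX)
  show "riem_inner p (X_field i p) T_vec = 0" "riem_inner p (Y_field i p) T_vec = 0"
    "riem_inner p T_vec T_vec = 1"
    by (simp_all only: * T_coeff_frame) (simp_all add: T_vec_def)
qed

lemma has_derivative_heis_mult_left:
  "(heis_mult p has_derivative (\<lambda>u. (fst u, snd u + 2 * im_form (fst p) (fst u)))) (at q)"
proof -
  have lin: "linear (im_form (fst p))"
    by (rule linearI) (simp_all add: im_form_def algebra_simps sum.distrib sum_subtractf sum_distrib_left)
  have "bounded_linear (\<lambda>u. (fst u, snd u + 2 * im_form (fst p) (fst u)))"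
    unfolding linear_conv_bounded_linear[symmetric]
    by (rule linearI) (simp_all add: linear_add[OF lin] linear_scale[OF lin] algebra_simps)
  then have "((\<lambda>q. p + (fst q, snd q + 2 * im_form (fst p) (fst q))) has_derivative
     (\<lambda>u. (fst u, snd u + 2 * im_form (fst p) (fst u)))) (at q)"
    using has_derivative_add[OF has_derivative_const bounded_linear_imp_has_derivative] by fastforce
  moreover have "heis_mult p = (\<lambda>q. p + (fst q, snd q + 2 * im_form (fst p) (fst q)))"
    by (auto simp: heis_mult_def prod_eq_iff)
  ultimately show ?thesis by simp
qed

lemma riem_inner_left_invariant:
  assumes "(heis_mult p has_derivative D) (at q)"
  shows "riem_inner (heis_mult p q) (D u) (D v) = riem_inner q u v"
proof -
  have D: "D = (\<lambda>u. (fst u, snd u + 2 * im_form (fst p) (fst u)))"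
    using assms has_derivative_heis_mult_left by (rule has_derivative_unique)
  have "im_form (fst p + fst q) w = im_form (fst p) w + im_form (fst q) w" for w
    by (simp add: im_form_def algebra_simps sum.distrib sum_subtractf)
  then show ?thesis
    by (simp add: D riem_inner_def T_coeff_def heis_mult_def)
qed

definition abs_continuous_curve :: "real \<Rightarrow> real \<Rightarrow> (real \<Rightarrow> 'a::metric_space) \<Rightarrow> bool" where
  "abs_continuous_curve a b \<gamma> \<longleftrightarrow>
     (\<forall>\<epsilon>>0. \<exists>\<delta>>0. \<forall>m. \<forall>s t :: nat \<Rightarrow> real.
        (\<forall>i<m. a \<le> s i \<and> s i \<le> t i \<and> t i \<le> b)
        \<and> (\<forall>i<m. \<forall>j<m. i \<noteq> j \<longrightarrow> {s i<..<t i} \<inter> {s j<..<t j} = {})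
        \<and> (\<Sum>i<m. t i - s i) < \<delta>
        \<longrightarrow> (\<Sum>i<m. dist (\<gamma> (s i)) (\<gamma> (t i))) < \<epsilon>)"

definition horizontal_curve :: "real \<Rightarrow> real \<Rightarrow> (real \<Rightarrow> 'n::finite heis) \<Rightarrow> bool" where
  "horizontal_curve a b \<gamma> \<longleftrightarrow>
     abs_continuous_curve a b \<gamma> \<and>
     (AE \<tau> in lebesgue_on {a..b}.
        \<exists>v \<in> horizontal_space (\<gamma> \<tau>). (\<gamma> has_vector_derivative v) (at \<tau>))"

text \<open>Lengths, distances and diameters live in \<^typ>\<open>ennreal\<close>, so that suprema and infima
  (\<open>Inf {} = \<infinity>\<close>) need no side conditions.\<close>

definition riem_length :: "real \<Rightarrow> real \<Rightarrow> (real \<Rightarrow> 'n::finite heis) \<Rightarrow> ennreal" where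
  "riem_length a b \<gamma> =
     (\<integral>\<^sup>+ \<tau>. ennreal (riem_norm (\<gamma> \<tau>) (vector_derivative \<gamma> (at \<tau>))) \<partial>lebesgue_on {a..b})"

definition cc_dist :: "'n::finite heis \<Rightarrow> 'n heis \<Rightarrow> ennreal" where
  "cc_dist p q =
     Inf {riem_length a b \<gamma> | a b \<gamma>. a \<le> b \<and> horizontal_curve a b \<gamma> \<and> \<gamma> a = p \<and> \<gamma> b = q}"

definition cc_cball :: "'n::finite heis \<Rightarrow> real \<Rightarrow> 'n heis set" where
  "cc_cball p s = {q. cc_dist p q \<le> ennreal s}"

definition cc_diam :: "'n::finite heis set \<Rightarrow> ennreal" where
  "cc_diam A = (SUP p\<in>A. SUP q\<in>A. cc_dist p q)"

definition rho :: "real \<Rightarrow> real" where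
  "rho \<phi> = (if \<phi> = 0 then 1 else sin \<phi> / \<phi>)"

definition g_fun :: "real \<Rightarrow> real" where
  "g_fun \<phi> = (if \<phi> = 0 then 0 else (2 * \<phi> - sin (2 * \<phi>)) / (2 * \<phi>\<^sup>2))"

definition h_fun :: "real \<Rightarrow> real" where
  "h_fun = g_fun \<circ> the_inv_into {0..pi} rho"

definition h_scaled :: "real \<Rightarrow> real \<Rightarrow> real" where
  "h_scaled \<mu> s = \<mu>\<^sup>2 * h_fun (s / \<mu>)"

text \<open>Meaningful for \<open>0 \<le> s \<le> lam/2\<close>; the two branches agree at \<open>s = lam/pi\<close>.\<close>

definition l_profile :: "real \<Rightarrow> real \<Rightarrow> real" where
  "l_profile lam s = (if s \<le> lam / pi then lam\<^sup>2 / (2 * pi) else h_scaled (lam / 2) s)"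

definition A_set :: "real \<Rightarrow> 'n::finite heis set" where
  "A_set lam = {(z, t). 2 * norm z \<le> lam \<and> \<bar>t\<bar> \<le> l_profile lam (norm z)}"

definition A2_set :: "real \<Rightarrow> 'n::finite heis set" where
  "A2_set lam = cc_cball (0, 0) (lam / 2) \<inter> {(z, t). norm z \<ge> lam / pi}"

definition A_pert :: "real \<Rightarrow> (complex ^ 'n::finite \<Rightarrow> real) \<Rightarrow> 'n heis set" where
  "A_pert lam f =
     {(z, t). norm z \<le> lam / pi \<and> 2 * pi * \<bar>t - f z\<bar> \<le> lam\<^sup>2} \<union> A2_set lam"

definition Lip :: "('a::metric_space \<Rightarrow> real) \<Rightarrow> real" where
  "Lip f = Inf {C. C-lipschitz_on UNIV f}"

end

theory Submission
  imports Defs "HOL-Real_Asymp.Real_Asymp"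
begin

text \<open>A point \<open>[w, s]\<close> lies in the closed ball of radius \<open>L\<close> about the origin iff
  \<open>k cot k \<parallel>w\<parallel>\<^sup>2 + k \<bar>s\<bar> \<le> L\<^sup>2\<close> for all \<open>0 < k < \<pi>\<close>; the constraint \<open>k = \<phi>\<close> is active at the endpoints of
  circular arcs of angle \<open>2\<phi>\<close>.  These constraints are subadditive under the group law, so
  \<open>d([z, t], [z', t']) \<le> \<lambda>\<close> already follows if both points satisfy them with \<open>L = \<lambda>/2\<close> for \<open>k < \<pi>/2\<close> only,
  and these half constraints hold on all of \<open>A_\<lambda>\<close>, where the ball has been filled up at the poles.
  Close to the axis only \<open>k = \<pi>/2\<close> is critical there; the resulting slack, together with
  \<open>cot (2k) \<longlongrightarrow> - \<infinity>\<close> as \<open>k \<longlongrightarrow> \<pi>/2\<close>, absorbs a perturbation by a function with small support and small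
  Lipschitz constant.  The volume is unchanged because vertical slices are only translated.\<close>

section \<open>Absolutely continuous curves\<close>

text \<open>The obstacle is that the set is not contained in the ball of radius
  \<open>lam / 2\<close>: over the axis it is twice as high, so the triangle inequality through the
  origin does not bound the diameter by \<open>lam\<close>. Splitting a constraint with parameter
  \<open>k\<close> on the difference of two points into constraints with parameter
  \<open>k / 2\<close> on the points avoids this: the dent of the ball at its poles is cut out by
  parameters above \<open>pi / 2\<close>, and these never occur as halves. No theory of geodesics
  enters. The lower bound on lengths is a calibration valid along every horizontal curve, the upper
  bound comes from explicit arcs, and their agreement identifies the balls. The value
  \<open>r = 1 / 20\<close> is chosen with room to spare. Near the axis the oscillation of
  \<open>f\<close> and the form \<open>im_form\<close> are each at most \<open>lam / 20\<close>
  times the horizontal separation of the two points, which the cotangent term absorbs. Away from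
  \<open>pi / 2\<close> the constraints leave a gap proportional to \<open>lam^2\<close>, larger
  than the values of \<open>f\<close>.\<close>

lemma abs_continuous_curveE:
  assumes "abs_continuous_curve a b f" "0 < \<epsilon>"
  obtains \<delta> where "0 < \<delta>" and "\<And>m (s :: nat \<Rightarrow> real) t.
      (\<And>i. i < m \<Longrightarrow> a \<le> s i \<and> s i \<le> t i \<and> t i \<le> b) \<Longrightarrow>
      (\<And>i j. i < m \<Longrightarrow> j < m \<Longrightarrow> i \<noteq> j \<Longrightarrow> {s i<..<t i} \<inter> {s j<..<t j} = {}) \<Longrightarrow>
      (\<Sum>i<m. t i - s i) < \<delta> \<Longrightarrow> (\<Sum>i<m. dist (f (s i)) (f (t i))) < \<epsilon>"
proof -
  obtain \<delta> where \<delta>: "0 < \<delta>" and acd: "\<forall>m. \<forall>s t :: nat \<Rightarrow> real.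
        (\<forall>i<m. a \<le> s i \<and> s i \<le> t i \<and> t i \<le> b)
        \<and> (\<forall>i<m. \<forall>j<m. i \<noteq> j \<longrightarrow> {s i<..<t i} \<inter> {s j<..<t j} = {})
        \<and> (\<Sum>i<m. t i - s i) < \<delta>
        \<longrightarrow> (\<Sum>i<m. dist (f (s i)) (f (t i))) < \<epsilon>"
    using assms unfolding abs_continuous_curve_def by blast
  show ?thesis
    by (rule that[OF \<delta>], rule acd[rule_format]) blast
qed

text \<open>A mean value inequality: tags in the exceptional null set are covered by an open set so small that
  absolute continuity makes their contribution negligible.\<close>

lemma ac_increment_le_integral:
  fixes f :: "real \<Rightarrow> 'a::real_normed_vector"
  assumes ac: "abs_continuous_curve a b f" and xy: "a \<le> x" "x \<le> y" "y \<le> b"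
    and N: "negligible N"
    and der: "\<And>\<tau>. \<tau> \<in> {x..y} - N \<Longrightarrow>
      \<exists>v. (f has_vector_derivative v) (at \<tau> within {x..y}) \<and> norm v \<le> M \<tau>"
    and M: "(M has_integral J) {x..y}" and nonneg: "\<And>\<tau>. 0 \<le> M \<tau>"
  shows "norm (f y - f x) \<le> J"
proof (rule field_le_epsilon)
  fix e :: real assume e: "0 < e"
  \<comment> \<open>The error budget: \<open>\<eta>\<close> for the cells tagged in
    \<open>N\<close>, \<open>\<eta>\<close> for the Riemann sum of \<open>M\<close>, and
    \<open>\<eta> * (y - x)\<close> for the linear approximation at good tags.\<close>
  define \<eta> where "\<eta> = e / (2 + (y - x))"
  have \<eta>: "0 < \<eta>" and \<eta>e: "\<eta> * (2 + (y - x)) = e"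
    using e xy by (auto simp: \<eta>_def)
  obtain \<delta> where \<delta>: "0 < \<delta>" and acd: "\<And>m (s :: nat \<Rightarrow> real) t.
      (\<And>i. i < m \<Longrightarrow> a \<le> s i \<and> s i \<le> t i \<and> t i \<le> b) \<Longrightarrow>
      (\<And>i j. i < m \<Longrightarrow> j < m \<Longrightarrow> i \<noteq> j \<Longrightarrow> {s i<..<t i} \<inter> {s j<..<t j} = {}) \<Longrightarrow>
      (\<Sum>i<m. t i - s i) < \<delta> \<Longrightarrow> (\<Sum>i<m. dist (f (s i)) (f (t i))) < \<eta>"
    using abs_continuous_curveE[OF ac \<eta>] by blast
  obtain U where U: "open U" "N \<subseteq> U" "U \<in> lmeasurable" "measure lebesgue U < \<delta>"
  proof -
    have Ns: "N \<in> null_sets lebesgue" using N by (simp add: negligible_iff_null_sets)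
    then obtain T where T: "open T" "N \<subseteq> T" "T - N \<in> lmeasurable" "emeasure lebesgue (T - N) < ennreal \<delta>"
      using sets_lebesgue_outer_open[of N \<delta>] \<delta> by auto
    have eq: "emeasure lebesgue T = emeasure lebesgue (T - N)"
      using emeasure_Diff_null_set[OF Ns, of T] T by auto
    have TL: "T \<in> lmeasurable"
      using T eq by (auto simp: fmeasurable_def)
    moreover have "measure lebesgue T < \<delta>"
      using T(4) unfolding eq[symmetric] emeasure_eq_measure2[OF TL] by (simp add: ennreal_less_iff)
    ultimately show ?thesis using that T by auto
  qed
  obtain \<gamma>1 where \<gamma>1: "gauge \<gamma>1" and int1: "\<And>p. p tagged_division_of {x..y} \<Longrightarrow> \<gamma>1 fine p \<Longrightarrow>
      norm ((\<Sum>(t,k)\<in>p. measure lborel k *\<^sub>R M t) - J) < \<eta>"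
    using M \<eta> unfolding has_integral_real by metis
  have "\<exists>d>0. \<forall>u v. u \<in> {x..y} \<and> v \<in> {x..y} \<and> u \<le> \<tau> \<and> \<tau> \<le> v \<and> {u..v} \<subseteq> ball \<tau> d
         \<longrightarrow> norm (f v - f u) \<le> (M \<tau> + \<eta>) * (v - u)" if \<tau>: "\<tau> \<in> {x..y} - N" for \<tau>
  proof -
    obtain v where v: "(f has_vector_derivative v) (at \<tau> within {x..y})" "norm v \<le> M \<tau>"
      using der[OF \<tau>] by auto
    then obtain d where d: "0 < d" and dd: "\<And>w. w \<in> {x..y} \<Longrightarrow> norm (w - \<tau>) < d \<Longrightarrow>
        norm (f w - f \<tau> - (w - \<tau>) *\<^sub>R v) \<le> \<eta> * norm (w - \<tau>)"
      using \<eta> unfolding has_vector_derivative_def has_derivative_within_alt by metis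
    have bd: "norm (f w - f \<tau>) \<le> (M \<tau> + \<eta>) * \<bar>w - \<tau>\<bar>" if "w \<in> {x..y}" "w \<in> ball \<tau> d" for w
    proof -
      have "norm (f w - f \<tau>) \<le> norm (f w - f \<tau> - (w - \<tau>) *\<^sub>R v) + norm ((w - \<tau>) *\<^sub>R v)"
        using norm_triangle_ineq[of "f w - f \<tau> - (w - \<tau>) *\<^sub>R v" "(w - \<tau>) *\<^sub>R v"] by simp
      also have "\<dots> \<le> \<eta> * \<bar>w - \<tau>\<bar> + \<bar>w - \<tau>\<bar> * M \<tau>"
        using dd[of w] that v(2) by (intro add_mono) (auto simp: dist_norm mult_left_mono abs_minus_commute)
      finally show ?thesis by (simp add: algebra_simps)
    qed
    have "norm (f w - f u) \<le> (M \<tau> + \<eta>) * (w - u)"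
      if h: "u \<in> {x..y}" "w \<in> {x..y}" "u \<le> \<tau>" "\<tau> \<le> w" "{u..w} \<subseteq> ball \<tau> d" for u w
    proof -
      have "norm (f w - f u) \<le> norm (f w - f \<tau>) + norm (f u - f \<tau>)"
        using norm_triangle_ineq4[of "f w - f \<tau>" "f u - f \<tau>"] by simp
      also have "\<dots> \<le> (M \<tau> + \<eta>) * \<bar>w - \<tau>\<bar> + (M \<tau> + \<eta>) * \<bar>u - \<tau>\<bar>"
        using h subsetD[OF h(5), of u] subsetD[OF h(5), of w] by (intro add_mono bd) auto
      finally show ?thesis using h by (simp add: algebra_simps)
    qed
    then show ?thesis using d by auto
  qed
  then obtain d where d: "\<And>\<tau>. \<tau> \<in> {x..y} - N \<Longrightarrow> 0 < d \<tau>"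
    and dd: "\<And>\<tau> u v. \<tau> \<in> {x..y} - N \<Longrightarrow> u \<in> {x..y} \<Longrightarrow> v \<in> {x..y} \<Longrightarrow> u \<le> \<tau> \<Longrightarrow> \<tau> \<le> v \<Longrightarrow>
       {u..v} \<subseteq> ball \<tau> (d \<tau>) \<Longrightarrow> norm (f v - f u) \<le> (M \<tau> + \<eta>) * (v - u)"
    by metis
  \<comment> \<open>Cells tagged in \<open>N\<close> are forced into \<open>U\<close>, the others
    into the range of the linear approximation. \<open>UNIV\<close> is a filler, since no tag lies
    outside \<open>{x..y}\<close>.\<close>
  define \<gamma>2 where "\<gamma>2 \<tau> = (if \<tau> \<in> N then U else if \<tau> \<in> {x..y} then ball \<tau> (d \<tau>) else UNIV)" for \<tau>
  have "gauge \<gamma>2"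
    using U d by (auto simp: gauge_def \<gamma>2_def)
  then have "gauge (\<lambda>t. \<gamma>1 t \<inter> \<gamma>2 t)" using \<gamma>1 by (rule gauge_Int[rotated])
  then obtain p where p: "p tagged_division_of {x..y}" and "(\<lambda>t. \<gamma>1 t \<inter> \<gamma>2 t) fine p"
    by (rule fine_division_exists_real)
  then have fine: "\<gamma>1 fine p" "\<gamma>2 fine p" by (auto simp: fine_Int)
  have finp: "finite p" using p by auto
  define B where "B = {q \<in> p. fst q \<in> N}"
  have finB: "finite B" using finp by (simp add: B_def)
  have cell: "snd q = {Inf (snd q)..Sup (snd q)} \<and> fst q \<in> snd q \<and> x \<le> Inf (snd q) \<and> Inf (snd q) \<le> fst q \<and> 
      fst q \<le> Sup (snd q) \<and> Sup (snd q) \<le> y \<and> measure lborel (snd q) = Sup (snd q) - Inf (snd q)" if qp: "q \<in> p" for q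
  proof -
    obtain t k where q: "q = (t,k)" by force
    have tk: "t \<in> k" "k \<subseteq> {x..y}" using tagged_division_ofD(2,3)[OF p] qp q by auto
    obtain u v where k: "k = {u..v}" using tagged_division_ofD(4)[OF p, of t k] qp q by auto
    then show ?thesis using tk q by auto
  qed
  have tele: "(\<Sum>q\<in>p. f (Sup (snd q)) - f (Inf (snd q))) = f y - f x"
    using additive_tagged_division_1[OF xy(2) p, of f] by (simp add: case_prod_beta')
  have sumc: "(\<Sum>q\<in>p. measure lborel (snd q)) = y - x"
    using additive_content_tagged_division[of p x y] p xy by (simp add: case_prod_beta')
  have good: "norm (f (Sup (snd q)) - f (Inf (snd q))) \<le> (M (fst q) + \<eta>) * measure lborel (snd q)"
    if q: "q \<in> p - B" for q
  proof -
    have qN: "fst q \<in> {x..y} - N" using q cell[of q] by (auto simp: B_def)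
    have "snd q \<subseteq> \<gamma>2 (fst q)" using fine(2) q unfolding fine_def by (cases q) auto
    then have "snd q \<subseteq> ball (fst q) (d (fst q))" using qN by (auto simp: \<gamma>2_def)
    then show ?thesis
      using dd[OF qN, of "Inf (snd q)" "Sup (snd q)"] cell[of q] q by auto
  qed
  have bad: "(\<Sum>q\<in>B. norm (f (Sup (snd q)) - f (Inf (snd q)))) < \<eta>"
  proof -
    \<comment> \<open>Absolute continuity speaks of families indexed by the numbers below
      \<open>m\<close>, so the bad cells are enumerated.\<close>
    obtain h where h: "bij_betw h {..<card B} B"
      using ex_bij_betw_nat_finite[OF finB] by (auto simp: atLeast0LessThan)
    define s t where "s i = Inf (snd (h i))" and "t i = Sup (snd (h i))" for i
    have hB: "h i \<in> B" "h i \<in> p" if "i < card B" for i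
      using h that by (auto simp: bij_betw_def B_def)
    have disj: "{s i<..<t i} \<inter> {s j<..<t j} = {}" if ij: "i < card B" "j < card B" "i \<noteq> j" for i j
    proof -
      have "h i \<noteq> h j" using h ij by (auto simp: bij_betw_def inj_on_def)
      then have "interior (snd (h i)) \<inter> interior (snd (h j)) = {}"
        using tagged_division_ofD(5)[OF p, of "fst (h i)" "snd (h i)" "fst (h j)" "snd (h j)"] hB ij
        by (auto simp: prod_eq_iff)
      moreover have "interior (snd (h i)) = {s i<..<t i}" if "i < card B" for i
        using cell[OF hB(2)[OF that]] unfolding s_def t_def by (metis interior_atLeastAtMost_real)
      ultimately show ?thesis using ij by simp
    qed
    have "(\<Sum>i<card B. t i - s i) = (\<Sum>i<card B. measure lebesgue {s i<..<t i})"
    proof (intro sum.cong refl)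
      fix i assume "i \<in> {..<card B}"
      then have "s i \<le> t i" using cell[of "h i"] hB[of i] unfolding s_def t_def by force
      then show "t i - s i = measure lebesgue {s i<..<t i}" by simp
    qed
    also have "\<dots> = measure lebesgue (\<Union>i<card B. {s i<..<t i})"
      using disj by (intro measure_UNION'[symmetric]) (auto simp: pairwise_def disjnt_def)
    also have "\<dots> \<le> measure lebesgue U"
    proof (rule measure_mono_fmeasurable)
      have "{s i<..<t i} \<subseteq> U" if i: "i < card B" for i
      proof -
        have "snd (h i) \<subseteq> \<gamma>2 (fst (h i))" using fine(2) hB[OF i] unfolding fine_def by (cases "h i") auto
        then have "snd (h i) \<subseteq> U" using hB[OF i] by (auto simp: \<gamma>2_def B_def)
        moreover have "{s i<..<t i} \<subseteq> {s i..t i}" by auto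
        ultimately show ?thesis using cell[OF hB(2)[OF i]] unfolding s_def t_def by blast
      qed
      then show "(\<Union>i<card B. {s i<..<t i}) \<subseteq> U" by auto
    qed (use U in auto)
    also have "\<dots> < \<delta>" by fact
    finally have len: "(\<Sum>i<card B. t i - s i) < \<delta>" .
    have rng: "a \<le> s i \<and> s i \<le> t i \<and> t i \<le> b" if "i < card B" for i
      using cell[OF hB(2)[OF that]] xy unfolding s_def t_def by linarith
    have "(\<Sum>i<card B. dist (f (s i)) (f (t i))) < \<eta>"
      using rng disj len by (intro acd)
    also have "(\<Sum>i<card B. dist (f (s i)) (f (t i))) = (\<Sum>q\<in>B. norm (f (Sup (snd q)) - f (Inf (snd q))))"
      using sum.reindex_bij_betw[OF h, of "\<lambda>q. norm (f (Sup (snd q)) - f (Inf (snd q)))"]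
      by (simp add: s_def t_def dist_norm norm_minus_commute)
    finally show ?thesis .
  qed
  have "norm (f y - f x) \<le> (\<Sum>q\<in>p. norm (f (Sup (snd q)) - f (Inf (snd q))))"
    unfolding tele[symmetric] by (rule norm_sum)
  also have "\<dots> = (\<Sum>q\<in>p-B. norm (f (Sup (snd q)) - f (Inf (snd q)))) + (\<Sum>q\<in>B. norm (f (Sup (snd q)) - f (Inf (snd q))))"
    using finp by (intro sum.subset_diff) (auto simp: B_def)
  also have "\<dots> \<le> (\<Sum>q\<in>p-B. (M (fst q) + \<eta>) * measure lborel (snd q)) + \<eta>"
    using bad good by (intro add_mono sum_mono) auto
  \<comment> \<open>Adding back the bad cells only increases the sum, because \<open>M\<close> is
    nonnegative.\<close>
  also have "(\<Sum>q\<in>p-B. (M (fst q) + \<eta>) * measure lborel (snd q)) \<le> (\<Sum>q\<in>p. (M (fst q) + \<eta>) * measure lborel (snd q))"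
    using finp nonneg \<eta> by (intro sum_mono2) (auto intro!: mult_nonneg_nonneg add_nonneg_nonneg less_imp_le)
  also have "(\<Sum>q\<in>p. (M (fst q) + \<eta>) * measure lborel (snd q)) = (\<Sum>(t,k)\<in>p. measure lborel k *\<^sub>R M t) + \<eta> * (y - x)"
    unfolding sumc[symmetric] sum_distrib_left sum.distrib[symmetric]
    by (simp add: case_prod_beta' algebra_simps)
  also have "(\<Sum>(t,k)\<in>p. measure lborel k *\<^sub>R M t) \<le> J + \<eta>"
    using int1[OF p fine(1)] by (auto simp: abs_if split: if_splits)
  finally show "norm (f y - f x) \<le> J + e" using \<eta>e by (simp add: algebra_simps)
qed

section \<open>The subadditive cotangent form\<close>

lemma im_form_add_left: "im_form (u + v) w = im_form u w + im_form v w"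
  by (simp add: im_form_def algebra_simps sum.distrib sum_subtractf)

lemma im_form_add_right: "im_form u (v + w) = im_form u v + im_form u w"
  by (simp add: im_form_def algebra_simps sum.distrib sum_subtractf)

lemma im_form_scaleR_left: "im_form (r *\<^sub>R u) v = r * im_form u v"
  by (simp add: im_form_def algebra_simps sum_subtractf sum_distrib_left)

lemma im_form_scaleR_right: "im_form u (r *\<^sub>R v) = r * im_form u v"
  by (simp add: im_form_def algebra_simps sum_subtractf sum_distrib_left)

lemma im_form_minus_left: "im_form (- u) v = - im_form u v"
  using im_form_scaleR_left[of "-1" u v] by simp

lemma im_form_minus_right: "im_form u (- v) = - im_form u v"
  using im_form_scaleR_right[of u "-1" v] by simp

lemma im_form_diff_left: "im_form (u - v) w = im_form u w - im_form v w"
  using im_form_add_left[of u "- v" w] by (simp add: im_form_minus_left)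

lemma im_form_diff_right: "im_form u (v - w) = im_form u v - im_form u w"
  using im_form_add_right[of u v "- w"] by (simp add: im_form_minus_right)

lemma im_form_self [simp]: "im_form u u = 0"
  by (simp add: im_form_def algebra_simps)

lemma im_form_zero [simp]: "im_form 0 u = 0" "im_form u 0 = 0"
  by (simp_all add: im_form_def)

lemmas im_form_simps = im_form_add_left im_form_add_right im_form_diff_left im_form_diff_right
  im_form_minus_left im_form_minus_right im_form_scaleR_left im_form_scaleR_right

lemma norm_mult_vec: "norm ((\<chi> j. c * u $ j) :: complex ^ 'n::finite) = norm c * norm u"
  by (simp add: norm_vec_def norm_mult L2_set_right_distrib)

text \<open>The left-hand side is the real inner product of \<open>(a - \<i> b) u\<close> and \<open>v\<close>.\<close>

lemma rotated_Cauchy_Schwarz: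
  fixes u v :: "complex ^ 'n::finite"
  shows "a * (u \<bullet> v) + b * im_form u v \<le> sqrt (a\<^sup>2 + b\<^sup>2) * norm u * norm v"
proof -
  have "(\<chi> j. Complex a (- b) * u $ j) \<bullet> v = a * (u \<bullet> v) + b * im_form u v"
    by (simp add: inner_vec_def inner_complex_def im_form_def sum_distrib_left sum.distrib[symmetric] algebra_simps)
  then show ?thesis
    using norm_cauchy_schwarz[of "\<chi> j. Complex a (- b) * u $ j" v] 
    by (simp add: norm_mult_vec complex_norm)
qed

lemma abs_im_form_le: "\<bar>im_form u v\<bar> \<le> norm u * norm v"
  using rotated_Cauchy_Schwarz[of 0 u v 1] rotated_Cauchy_Schwarz[of 0 u v "-1"] by simp

text \<open>After expansion of the square,
  \<open>cot x - cot (x + y) = sin y / (sin x * sin (x + y))\<close> and its mirror image leave a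
  mixed term and two squares. The mixed term is at most \<open>norm z * norm w\<close> by the
  rotated Cauchy-Schwarz inequality, as \<open>cos^2 + sin^2 = 1\<close>; the squares dominate it by
  the inequality of arithmetic and geometric means. Equality holds for consecutive chords of one
  circle with half-angles \<open>x\<close> and \<open>y\<close>, so nothing is lost along circular
  arcs.\<close>

lemma cot_form_subadditive:
  fixes z w :: "complex ^ 'n::finite"
  assumes "0 < x" "0 < y" "x + y < pi"
  shows "cot (x + y) * (norm (z + w))\<^sup>2 + 2 * \<bar>im_form z w\<bar> \<le> cot x * (norm z)\<^sup>2 + cot y * (norm w)\<^sup>2"
proof -
  define S C where "S = sin (x + y)" and "C = cos (x + y)"
  have pos: "0 < sin x" "0 < sin y" "0 < S" 
    using assms by (auto simp: S_def intro!: sin_gt_zero)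
  have "cos x * S - sin x * C = sin y"
    using sin_diff[of "x + y" x] by (simp add: S_def C_def algebra_simps)
  then have cx: "cot x = C / S + sin y / (sin x * S)"
    using pos by (simp add: cot_def field_simps)
  have "cos y * S - sin y * C = sin x"
    using sin_diff[of "x + y" y] by (simp add: S_def C_def algebra_simps)
  then have cy: "cot y = C / S + sin x / (sin y * S)"
    using pos by (simp add: cot_def field_simps)
  have "C * (z \<bullet> w) + sgn (im_form z w) * S * im_form z w \<le> sqrt (C\<^sup>2 + (sgn (im_form z w) * S)\<^sup>2) * norm z * norm w"
    by (rule rotated_Cauchy_Schwarz)
  \<comment> \<open>\<open>sgn\<close> is 0 when the form vanishes, so the radicand is only bounded
    by 1.\<close>
  also have "sqrt (C\<^sup>2 + (sgn (im_form z w) * S)\<^sup>2) \<le> sqrt 1"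
    by (intro real_sqrt_le_mono) (auto simp: C_def S_def sgn_real_def power_mult_distrib abs_square_le_1)
  also have "sgn (im_form z w) * S * im_form z w = S * \<bar>im_form z w\<bar>"
    by (simp add: sgn_real_def)
  finally have cs: "C * (z \<bullet> w) + S * \<bar>im_form z w\<bar> \<le> norm z * norm w"
    by (simp add: mult_right_mono)
  have "0 \<le> (sin y * norm z - sin x * norm w)\<^sup>2 / (sin x * sin y)"
    using pos by simp
  also have "\<dots> = sin y / sin x * (norm z)\<^sup>2 + sin x / sin y * (norm w)\<^sup>2 - 2 * (norm z * norm w)"
    using pos by (simp add: field_simps power2_eq_square)
  finally have "2 * (norm z * norm w) \<le> sin y / sin x * (norm z)\<^sup>2 + sin x / sin y * (norm w)\<^sup>2"
    by simp
  then have "2 * (C * (z \<bullet> w) + S * \<bar>im_form z w\<bar>) \<le> sin y / sin x * (norm z)\<^sup>2 + sin x / sin y * (norm w)\<^sup>2"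
    using mult_left_mono[OF cs, of 2] by (meson order_trans zero_le_numeral)
  then have "2 * (C * (z \<bullet> w) + S * \<bar>im_form z w\<bar>) / S \<le> (sin y / sin x * (norm z)\<^sup>2 + sin x / sin y * (norm w)\<^sup>2) / S"
    using pos by (intro divide_right_mono) auto
  moreover have "cot x * (norm z)\<^sup>2 + cot y * (norm w)\<^sup>2 = 
     C / S * ((norm z)\<^sup>2 + (norm w)\<^sup>2) + (sin y / sin x * (norm z)\<^sup>2 + sin x / sin y * (norm w)\<^sup>2) / S"
    unfolding cx cy using pos by (simp add: field_simps)
  moreover have "cot (x + y) * (norm (z + w))\<^sup>2 + 2 * \<bar>im_form z w\<bar> =
     C / S * ((norm z)\<^sup>2 + (norm w)\<^sup>2) + 2 * (C * (z \<bullet> w) + S * \<bar>im_form z w\<bar>) / S"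
    using pos by (simp add: cot_def C_def[symmetric] S_def[symmetric] power2_norm_eq_inner inner_add inner_commute field_simps)
  ultimately show ?thesis by simp
qed

lemma x_cos_less_sin:
  assumes "0 < x" "x < pi"
  shows "x * cos x < sin (x::real)"
proof -
  have "x * cos x - sin x < 0 * cos 0 - sin 0"
  proof (rule DERIV_neg_imp_decreasing_open[where f = "\<lambda>t. t * cos t - sin t"])
    fix t :: real assume t: "0 < t" "t < x"
    then have "- (t * sin t) < 0" using assms sin_gt_zero[of t] by simp
    moreover have "((\<lambda>t. t * cos t - sin t) has_real_derivative - (t * sin t)) (at t)"
      by (auto intro!: derivative_eq_intros)
    ultimately show "\<exists>y. ((\<lambda>t. t * cos t - sin t) has_real_derivative y) (at t) \<and> y < 0" by blast
  qed (use assms in \<open>auto intro!: continuous_intros\<close>)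
  then show ?thesis by simp
qed

lemma cot_le_inverse:
  assumes "0 < x" "x < pi"
  shows "cot x \<le> 1 / (x::real)"
  using assms x_cos_less_sin[of x] sin_gt_zero[of x] by (simp add: cot_def field_simps)

text \<open>The horizontal bundle is the kernel of the contact form \<open>T_coeff\<close>;
  horizontality of translated and explicit curves thus becomes a single equation.\<close>

lemma T_coeff_eq_0_iff_horizontal: "u \<in> horizontal_space p \<longleftrightarrow> T_coeff p u = 0"
proof
  have "subspace {u. T_coeff p u = 0}"
    by (auto simp: subspace_def T_coeff_def im_form_simps algebra_simps)
  then have "horizontal_space p \<subseteq> {u. T_coeff p u = 0}"
    unfolding horizontal_space_def by (intro span_minimal) auto
  then show "u \<in> horizontal_space p \<Longrightarrow> T_coeff p u = 0" by auto
next
  assume u: "T_coeff p u = 0"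
  define U where "U = (\<Sum>j\<in>UNIV. Re (fst u $ j) *\<^sub>R X_field j p + Im (fst u $ j) *\<^sub>R Y_field j p)"
  have hor: "U \<in> horizontal_space p"
    unfolding U_def horizontal_space_def
    by (intro span_sum span_add span_scale) (auto intro: span_base)
  have "fst U = (\<Sum>j\<in>UNIV. axis j (fst u $ j))"
    unfolding U_def fst_sum
    by (intro sum.cong refl) (auto simp: X_field_def Y_field_def axis_def vec_eq_iff complex_eq_iff)
  also have "\<dots> = fst u"
    by (simp add: vec_eq_iff axis_def)
  finally have 1: "fst U = fst u" .
  have "snd U = 2 * im_form (fst p) (fst u)"
    unfolding U_def snd_sum im_form_def sum_distrib_left
    by (intro sum.cong refl) (simp add: X_field_def Y_field_def algebra_simps)
  then have "U = u"
    using 1 u by (simp add: prod_eq_iff T_coeff_def)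
  then show "u \<in> horizontal_space p" using hor by simp
qed

text \<open>The vertical coefficient vanishes, so the length of a horizontal curve is the Euclidean
  length of its projection to \<open>complex ^ 'n\<close>.\<close>

lemma riem_norm_horizontal:
  assumes "u \<in> horizontal_space p"
  shows "riem_norm p u = norm (fst u)"
  using assms
  by (simp add: T_coeff_eq_0_iff_horizontal riem_norm_def riem_inner_def norm_eq_sqrt_inner inner_vec_def inner_complex_def)

section \<open>Absolute continuity: compositions, continuity, Lipschitz curves\<close>

lemma abs_continuous_curve_lipschitz_compose:
  assumes ac: "abs_continuous_curve a b \<gamma>" and g: "C-lipschitz_on UNIV g"
  shows "abs_continuous_curve a b (\<lambda>\<tau>. g (\<gamma> \<tau>))"
  unfolding abs_continuous_curve_def
proof (intro allI impI)
  fix \<epsilon> :: real assume "0 < \<epsilon>"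
  have C: "0 \<le> C" using g by (rule lipschitz_on_nonneg)
  \<comment> \<open>Dividing by \<open>C + 1\<close> covers the case \<open>C = 0\<close>.\<close>
  then have "0 < \<epsilon> / (C + 1)" using \<open>0 < \<epsilon>\<close> by simp
  then obtain \<delta> where \<delta>: "0 < \<delta>" and acd: "\<And>m (s::nat \<Rightarrow> real) t.
      (\<And>i. i < m \<Longrightarrow> a \<le> s i \<and> s i \<le> t i \<and> t i \<le> b) \<Longrightarrow>
      (\<And>i j. i < m \<Longrightarrow> j < m \<Longrightarrow> i \<noteq> j \<Longrightarrow> {s i<..<t i} \<inter> {s j<..<t j} = {}) \<Longrightarrow>
      (\<Sum>i<m. t i - s i) < \<delta> \<Longrightarrow> (\<Sum>i<m. dist (\<gamma> (s i)) (\<gamma> (t i))) < \<epsilon> / (C + 1)"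
    using abs_continuous_curveE[OF ac] by blast
  show "\<exists>\<delta>>0. \<forall>m (s::nat \<Rightarrow> real) t. (\<forall>i<m. a \<le> s i \<and> s i \<le> t i \<and> t i \<le> b) \<and>
        (\<forall>i<m. \<forall>j<m. i \<noteq> j \<longrightarrow> {s i<..<t i} \<inter> {s j<..<t j} = {}) \<and>
        (\<Sum>i<m. t i - s i) < \<delta> \<longrightarrow> (\<Sum>i<m. dist (g (\<gamma> (s i))) (g (\<gamma> (t i)))) < \<epsilon>"
  proof (intro exI[of _ \<delta>] conjI allI impI \<delta>)
    fix m and s t :: "nat \<Rightarrow> real"
    assume h: "(\<forall>i<m. a \<le> s i \<and> s i \<le> t i \<and> t i \<le> b) \<and>
        (\<forall>i<m. \<forall>j<m. i \<noteq> j \<longrightarrow> {s i<..<t i} \<inter> {s j<..<t j} = {}) \<and>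
        (\<Sum>i<m. t i - s i) < \<delta>"
    have *: "(\<Sum>i<m. dist (\<gamma> (s i)) (\<gamma> (t i))) < \<epsilon> / (C + 1)"
      by (rule acd) (use h in blast)+
    have "(\<Sum>i<m. dist (g (\<gamma> (s i))) (g (\<gamma> (t i)))) \<le> (\<Sum>i<m. (C + 1) * dist (\<gamma> (s i)) (\<gamma> (t i)))"
    proof (intro sum_mono)
      fix i
      have "dist (g (\<gamma> (s i))) (g (\<gamma> (t i))) \<le> C * dist (\<gamma> (s i)) (\<gamma> (t i))"
        using g by (rule lipschitz_onD) auto
      then show "dist (g (\<gamma> (s i))) (g (\<gamma> (t i))) \<le> (C + 1) * dist (\<gamma> (s i)) (\<gamma> (t i))"
        by (simp add: distrib_right add_increasing2)
    qed
    also have "\<dots> < \<epsilon>"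
      using * C by (simp add: sum_distrib_left[symmetric] pos_less_divide_eq mult.commute)
    finally show "(\<Sum>i<m. dist (g (\<gamma> (s i))) (g (\<gamma> (t i)))) < \<epsilon>" .
  qed
qed

lemma abs_continuous_curve_imp_continuous_on:
  assumes ac: "abs_continuous_curve a b \<gamma>"
  shows "continuous_on {a..b} \<gamma>"
  unfolding continuous_on_iff
proof (intro ballI allI impI)
  fix x \<epsilon> :: real assume x: "x \<in> {a..b}" and "0 < \<epsilon>"
  then obtain \<delta> where \<delta>: "0 < \<delta>" and acd: "\<And>m (s::nat \<Rightarrow> real) t.
      (\<And>i. i < m \<Longrightarrow> a \<le> s i \<and> s i \<le> t i \<and> t i \<le> b) \<Longrightarrow>
      (\<And>i j. i < m \<Longrightarrow> j < m \<Longrightarrow> i \<noteq> j \<Longrightarrow> {s i<..<t i} \<inter> {s j<..<t j} = {}) \<Longrightarrow>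
      (\<Sum>i<m. t i - s i) < \<delta> \<Longrightarrow> (\<Sum>i<m. dist (\<gamma> (s i)) (\<gamma> (t i))) < \<epsilon>"
    using abs_continuous_curveE[OF ac] by blast
  have "dist (\<gamma> y) (\<gamma> x) < \<epsilon>" if "y \<in> {a..b}" "dist y x < \<delta>" for y
    using acd[of "Suc 0" "\<lambda>_. x" "\<lambda>_. y"] acd[of "Suc 0" "\<lambda>_. y" "\<lambda>_. x"] that x
    by (cases "x \<le> y") (auto simp: dist_real_def dist_commute)
  then show "\<exists>d>0. \<forall>y\<in>{a..b}. dist y x < d \<longrightarrow> dist (\<gamma> y) (\<gamma> x) < \<epsilon>"
    using \<delta> by auto
qed

lemma lipschitz_imp_abs_continuous_curve:
  assumes g: "C-lipschitz_on {a..b} \<gamma>"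
  shows "abs_continuous_curve a b \<gamma>"
  unfolding abs_continuous_curve_def
proof (intro allI impI)
  fix \<epsilon> :: real assume "0 < \<epsilon>"
  have C: "0 \<le> C" using g by (rule lipschitz_on_nonneg)
  show "\<exists>\<delta>>0. \<forall>m (s::nat \<Rightarrow> real) t. (\<forall>i<m. a \<le> s i \<and> s i \<le> t i \<and> t i \<le> b) \<and>
        (\<forall>i<m. \<forall>j<m. i \<noteq> j \<longrightarrow> {s i<..<t i} \<inter> {s j<..<t j} = {}) \<and>
        (\<Sum>i<m. t i - s i) < \<delta> \<longrightarrow> (\<Sum>i<m. dist (\<gamma> (s i)) (\<gamma> (t i))) < \<epsilon>"
  proof (intro exI[of _ "\<epsilon> / (C + 1)"] conjI allI impI)
    show "0 < \<epsilon> / (C + 1)" using C \<open>0 < \<epsilon>\<close> by simp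
    fix m and s t :: "nat \<Rightarrow> real"
    assume h: "(\<forall>i<m. a \<le> s i \<and> s i \<le> t i \<and> t i \<le> b) \<and>
        (\<forall>i<m. \<forall>j<m. i \<noteq> j \<longrightarrow> {s i<..<t i} \<inter> {s j<..<t j} = {}) \<and>
        (\<Sum>i<m. t i - s i) < \<epsilon> / (C + 1)"
    have "(\<Sum>i<m. dist (\<gamma> (s i)) (\<gamma> (t i))) \<le> (\<Sum>i<m. (C + 1) * (t i - s i))"
    proof (intro sum_mono)
      fix i assume "i \<in> {..<m}"
      then have i: "a \<le> s i" "s i \<le> t i" "t i \<le> b" using h by auto
      have "dist (\<gamma> (s i)) (\<gamma> (t i)) \<le> C * dist (s i) (t i)"
        using g by (rule lipschitz_onD) (use i in auto)
      then show "dist (\<gamma> (s i)) (\<gamma> (t i)) \<le> (C + 1) * (t i - s i)"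
        using i by (simp add: dist_real_def distrib_right)
    qed
    also have "\<dots> < \<epsilon>"
      using h C by (simp add: sum_distrib_left[symmetric] pos_less_divide_eq mult.commute)
    finally show "(\<Sum>i<m. dist (\<gamma> (s i)) (\<gamma> (t i))) < \<epsilon>" .
  qed
qed

text \<open>Subadditivity of the left-hand side reduces the claim to short subintervals, where \<open>cot x \<le> 1 / x\<close>
  leaves an error quadratic in the length.\<close>

lemma cot_calibration:
  fixes \<gamma> :: "real \<Rightarrow> 'n::finite heis"
  assumes ab: "a < b" and cont: "continuous_on {a..b} \<sigma>"
    and mono: "\<And>x y. a \<le> x \<Longrightarrow> x < y \<Longrightarrow> y \<le> b \<Longrightarrow> \<sigma> x < \<sigma> y"
    and z: "\<And>x y. a \<le> x \<Longrightarrow> x < y \<Longrightarrow> y \<le> b \<Longrightarrow> norm (fst (\<gamma> y) - fst (\<gamma> x)) \<le> \<sigma> y - \<sigma> x"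
    and t: "\<And>x y. a \<le> x \<Longrightarrow> x < y \<Longrightarrow> y \<le> b \<Longrightarrow>
      \<bar>snd (\<gamma> y) - snd (\<gamma> x) - 2 * im_form (fst (\<gamma> x)) (fst (\<gamma> y))\<bar> \<le> 2 * (\<sigma> y - \<sigma> x)\<^sup>2"
    and c: "0 < c" "c * (\<sigma> b - \<sigma> a) < pi"
  shows "c * cot (c * (\<sigma> b - \<sigma> a)) * (norm (fst (\<gamma> b) - fst (\<gamma> a)))\<^sup>2 +
    c * \<bar>snd (\<gamma> b) - snd (\<gamma> a) - 2 * im_form (fst (\<gamma> a)) (fst (\<gamma> b))\<bar> \<le> \<sigma> b - \<sigma> a"
proof -
  define s where "s x y = snd (\<gamma> y) - snd (\<gamma> x) - 2 * im_form (fst (\<gamma> x)) (fst (\<gamma> y))" for x y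
  define F where "F x y = c * cot (c * (\<sigma> y - \<sigma> x)) * (norm (fst (\<gamma> y) - fst (\<gamma> x)))\<^sup>2 + c * \<bar>s x y\<bar>" for x y
  have rng: "0 < c * (\<sigma> y - \<sigma> x)" "c * (\<sigma> y - \<sigma> x) < pi" if "a \<le> x" "x < y" "y \<le> b" for x y
  proof -
    show "0 < c * (\<sigma> y - \<sigma> x)" using mono[OF that] c by simp
    have "\<sigma> a \<le> \<sigma> x" using mono[of a x] that by (cases "a = x") (auto simp: less_eq_real_def)
    moreover have "\<sigma> y \<le> \<sigma> b" using mono[of y b] that by (cases "b = y") (auto simp: less_eq_real_def)
    ultimately have "c * (\<sigma> y - \<sigma> x) \<le> c * (\<sigma> b - \<sigma> a)" using c by simp
    then show "c * (\<sigma> y - \<sigma> x) < pi" using c by linarith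
  qed
  have main: "F a b \<le> (1 + \<epsilon>) * (\<sigma> b - \<sigma> a)" if \<epsilon>: "0 < \<epsilon>" for \<epsilon>
  proof -
    \<comment> \<open>\<open>Bolzano\<close> argues by bisection: a property that passes to unions
      of adjacent intervals holds globally once it holds on short ones. The guard
      \<open>x < y\<close> makes degenerate intervals vacuous, and the factor
      \<open>1 + \<epsilon>\<close> leaves room for the quadratic error.\<close>
    have "a \<le> a \<and> a < b \<and> b \<le> b \<longrightarrow> F a b \<le> (1 + \<epsilon>) * (\<sigma> b - \<sigma> a)"
    proof (rule Bolzano[of a b "\<lambda>x y. a \<le> x \<and> x < y \<and> y \<le> b \<longrightarrow> F x y \<le> (1 + \<epsilon>) * (\<sigma> y - \<sigma> x)"])
      fix x y w
      assume h1: "a \<le> x \<and> x < y \<and> y \<le> b \<longrightarrow> F x y \<le> (1 + \<epsilon>) * (\<sigma> y - \<sigma> x)"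
        and h2: "a \<le> y \<and> y < w \<and> w \<le> b \<longrightarrow> F y w \<le> (1 + \<epsilon>) * (\<sigma> w - \<sigma> y)"
        and xyw: "x \<le> y" "y \<le> w"
      show "a \<le> x \<and> x < w \<and> w \<le> b \<longrightarrow> F x w \<le> (1 + \<epsilon>) * (\<sigma> w - \<sigma> x)"
      proof (cases "x < y \<and> y < w \<and> a \<le> x \<and> w \<le> b")
        case False
        then show ?thesis using h1 h2 xyw by (metis less_eq_real_def)
      next
        case True
        have split: "c * (\<sigma> w - \<sigma> x) = c * (\<sigma> y - \<sigma> x) + c * (\<sigma> w - \<sigma> y)" by (simp add: algebra_simps)
        have "cot (c * (\<sigma> w - \<sigma> x)) * (norm (fst (\<gamma> w) - fst (\<gamma> x)))\<^sup>2
            + 2 * \<bar>im_form (fst (\<gamma> y) - fst (\<gamma> x)) (fst (\<gamma> w) - fst (\<gamma> y))\<bar>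
            \<le> cot (c * (\<sigma> y - \<sigma> x)) * (norm (fst (\<gamma> y) - fst (\<gamma> x)))\<^sup>2
             + cot (c * (\<sigma> w - \<sigma> y)) * (norm (fst (\<gamma> w) - fst (\<gamma> y)))\<^sup>2"
          using cot_form_subadditive[of "c * (\<sigma> y - \<sigma> x)" "c * (\<sigma> w - \<sigma> y)" 
              "fst (\<gamma> y) - fst (\<gamma> x)" "fst (\<gamma> w) - fst (\<gamma> y)"] True rng[of x y] rng[of y w] rng[of x w]
          unfolding split[symmetric] by simp
        moreover have "\<bar>s x w\<bar> \<le> \<bar>s x y\<bar> + \<bar>s y w\<bar> + 2 * \<bar>im_form (fst (\<gamma> y) - fst (\<gamma> x)) (fst (\<gamma> w) - fst (\<gamma> y))\<bar>"
        proof -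
          \<comment> \<open>Third coordinate of the identity
            \<open>p^-1 r = (p^-1 q) (q^-1 r)\<close> for the points of the curve at
            \<open>x\<close>, \<open>y\<close> and \<open>w\<close>.\<close>
          have "s x w = s x y + s y w + 2 * im_form (fst (\<gamma> y) - fst (\<gamma> x)) (fst (\<gamma> w) - fst (\<gamma> y))"
            by (simp add: s_def im_form_simps)
          then show ?thesis by linarith
        qed
        ultimately have "c * (cot (c * (\<sigma> w - \<sigma> x)) * (norm (fst (\<gamma> w) - fst (\<gamma> x)))\<^sup>2 + \<bar>s x w\<bar>)
           \<le> c * (cot (c * (\<sigma> y - \<sigma> x)) * (norm (fst (\<gamma> y) - fst (\<gamma> x)))\<^sup>2
             + cot (c * (\<sigma> w - \<sigma> y)) * (norm (fst (\<gamma> w) - fst (\<gamma> y)))\<^sup>2 + \<bar>s x y\<bar> + \<bar>s y w\<bar>)"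
          using c by (intro mult_left_mono) auto
        then have "F x w \<le> F x y + F y w" by (simp add: F_def algebra_simps)
        also have "\<dots> \<le> (1 + \<epsilon>) * (\<sigma> y - \<sigma> x) + (1 + \<epsilon>) * (\<sigma> w - \<sigma> y)"
          using h1 h2 True by (intro add_mono) auto
        finally show ?thesis by (simp add: algebra_simps)
      qed
    next
      fix x assume x: "a \<le> x" "x \<le> b"
      \<comment> \<open>Two increments below \<open>\<epsilon> / (4 * c)\<close> keep the total
        increment \<open>\<delta>\<close> below \<open>\<epsilon> / (2 * c)\<close>, so that the
        height term \<open>2 * c * \<delta>^2\<close> is at most
        \<open>\<epsilon> * \<delta>\<close>.\<close>
      have e': "0 < \<epsilon> / (4 * c)" using \<epsilon> c by simp
      then obtain d where d: "0 < d" and dd: "\<And>y. y \<in> {a..b} \<Longrightarrow> dist y x < d \<Longrightarrow> dist (\<sigma> y) (\<sigma> x) < \<epsilon> / (4 * c)"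
        using cont x unfolding continuous_on_iff by (metis atLeastAtMost_iff)
      show "\<exists>d>0. \<forall>u v. u \<le> x \<and> x \<le> v \<and> v - u < d \<longrightarrow> 
         (a \<le> u \<and> u < v \<and> v \<le> b \<longrightarrow> F u v \<le> (1 + \<epsilon>) * (\<sigma> v - \<sigma> u))"
      proof (intro exI[of _ d] conjI allI impI d)
        fix u v assume uv: "u \<le> x \<and> x \<le> v \<and> v - u < d" "a \<le> u \<and> u < v \<and> v \<le> b"
        define \<delta> where "\<delta> = \<sigma> v - \<sigma> u"
        have "dist (\<sigma> u) (\<sigma> x) < \<epsilon> / (4 * c)" "dist (\<sigma> v) (\<sigma> x) < \<epsilon> / (4 * c)"
          using uv x by (auto intro!: dd simp: dist_real_def[of u] dist_real_def[of v])
        then have "\<delta> < \<epsilon> / (4 * c) + \<epsilon> / (4 * c)" unfolding \<delta>_def dist_real_def by linarith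
        then have small: "2 * c * \<delta> \<le> \<epsilon>" using c by (simp add: field_simps)
        have \<delta>: "0 < \<delta>" using mono uv by (simp add: \<delta>_def)
        have "cot (c * \<delta>) \<le> 1 / (c * \<delta>)"
          using rng[of u v] uv by (intro cot_le_inverse) (auto simp: \<delta>_def)
        then have "c * cot (c * \<delta>) * (norm (fst (\<gamma> v) - fst (\<gamma> u)))\<^sup>2 \<le> c * (1 / (c * \<delta>)) * (norm (fst (\<gamma> v) - fst (\<gamma> u)))\<^sup>2"
          using c by (intro mult_right_mono mult_left_mono) auto
        also have "\<dots> \<le> c * (1 / (c * \<delta>)) * \<delta>\<^sup>2"
          using c \<delta> z[of u v] uv by (intro mult_left_mono power_mono) (auto simp: \<delta>_def)
        also have "\<dots> = \<delta>" using c \<delta> by (simp add: power2_eq_square)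
        finally have 1: "c * cot (c * \<delta>) * (norm (fst (\<gamma> v) - fst (\<gamma> u)))\<^sup>2 \<le> \<delta>" .
        have "c * \<bar>s u v\<bar> \<le> c * (2 * \<delta>\<^sup>2)"
          using t[of u v] uv c by (intro mult_left_mono) (auto simp: s_def \<delta>_def)
        also have "\<dots> = (2 * c * \<delta>) * \<delta>" by (simp add: power2_eq_square)
        also have "\<dots> \<le> \<epsilon> * \<delta>" using small \<delta> by (intro mult_right_mono) auto
        finally show "F u v \<le> (1 + \<epsilon>) * (\<sigma> v - \<sigma> u)" using 1 by (simp add: F_def \<delta>_def algebra_simps)
      qed
    qed (use ab in auto)
    then show ?thesis using ab by simp
  qed
  have "F a b \<le> \<sigma> b - \<sigma> a"
  proof (rule field_le_epsilon)
    fix e :: real assume e: "0 < e"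
    have L: "0 < \<sigma> b - \<sigma> a" using mono ab by simp
    then have "F a b \<le> (1 + e / (\<sigma> b - \<sigma> a)) * (\<sigma> b - \<sigma> a)" using e by (intro main) simp
    also have "\<dots> = \<sigma> b - \<sigma> a + e" using L by (simp add: distrib_right)
    finally show "F a b \<le> \<sigma> b - \<sigma> a + e" .
  qed
  then show ?thesis by (simp add: F_def s_def)
qed

section \<open>Lower bound for the distance\<close>

text \<open>\<open>\<sigma>\<close> is arc length plus a linear term that makes it strictly increasing.\<close>

lemma horizontal_curve_arclength:
  fixes \<gamma> :: "real \<Rightarrow> 'n::finite heis"
  assumes hc: "horizontal_curve a b \<gamma>" and ab: "a < b" and len: "riem_length a b \<gamma> < ennreal L"
  obtains \<sigma> where "continuous_on {a..b} \<sigma>" "\<sigma> a = 0" "\<sigma> b = L"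
    "\<And>x y. a \<le> x \<Longrightarrow> x < y \<Longrightarrow> y \<le> b \<Longrightarrow> \<sigma> x < \<sigma> y"
    "\<And>x y. a \<le> x \<Longrightarrow> x < y \<Longrightarrow> y \<le> b \<Longrightarrow> norm (fst (\<gamma> y) - fst (\<gamma> x)) \<le> \<sigma> y - \<sigma> x"
    "\<And>x y. a \<le> x \<Longrightarrow> x < y \<Longrightarrow> y \<le> b \<Longrightarrow>
      \<bar>snd (\<gamma> y) - snd (\<gamma> x) - 2 * im_form (fst (\<gamma> x)) (fst (\<gamma> y))\<bar> \<le> 2 * (\<sigma> y - \<sigma> x)\<^sup>2"
proof -
  have ac: "abs_continuous_curve a b \<gamma>" using hc by (simp add: horizontal_curve_def)
  define V where "V \<tau> = vector_derivative \<gamma> (at \<tau>)" for \<tau>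
  have "AE \<tau> in lebesgue. \<tau> \<in> {a..b} \<longrightarrow> (\<exists>v \<in> horizontal_space (\<gamma> \<tau>). (\<gamma> has_vector_derivative v) (at \<tau>))"
    using hc unfolding horizontal_curve_def by (subst (asm) AE_restrict_space_iff) auto
  then obtain N0 where N0: "N0 \<in> null_sets lebesgue"
    "{\<tau>. \<not> (\<tau> \<in> {a..b} \<longrightarrow> (\<exists>v \<in> horizontal_space (\<gamma> \<tau>). (\<gamma> has_vector_derivative v) (at \<tau>)))} \<subseteq> N0"
    unfolding eventually_ae_filter by auto
  \<comment> \<open>The measurability argument below rests on right difference quotients, which
    leave \<open>{a..b}\<close> at \<open>b\<close>.\<close>
  define N where "N = insert b N0"
  have N: "negligible N" using N0(1) by (simp add: N_def negligible_iff_null_sets)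
  then have Nnull: "N \<in> null_sets lebesgue" by (simp add: negligible_iff_null_sets)
  have good: "(\<gamma> has_vector_derivative V \<tau>) (at \<tau>)" "V \<tau> \<in> horizontal_space (\<gamma> \<tau>)" if \<tau>: "\<tau> \<in> {a..b} - N" for \<tau>
  proof -
    obtain v where v: "v \<in> horizontal_space (\<gamma> \<tau>)" "(\<gamma> has_vector_derivative v) (at \<tau>)"
      using \<tau> N0(2) unfolding N_def by blast
    then have "V \<tau> = v" unfolding V_def by (simp add: vector_derivative_at)
    then show "(\<gamma> has_vector_derivative V \<tau>) (at \<tau>)" "V \<tau> \<in> horizontal_space (\<gamma> \<tau>)" using v by auto
  qed
  define M where "M \<tau> = (if \<tau> \<in> {a..b} - N then norm (fst (V \<tau>)) else 0)" for \<tau>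
  have M0: "0 \<le> M \<tau>" for \<tau> by (simp add: M_def)
  \<comment> \<open>Measurability of the speed \<open>M\<close> has to be derived: on
    \<open>{a..b}\<close> it is the pointwise limit of right difference quotients of a continuous
    curve. Clamping the parameter extends the projected curve continuously to the whole line, and
    the indicator in \<open>u\<close> makes both sides 0 on \<open>N\<close>.\<close>
  define \<gamma>c where "\<gamma>c \<tau> = fst (\<gamma> (max a (min b \<tau>)))" for \<tau>
  have cont\<gamma>: "continuous_on {a..b} \<gamma>" using ac by (rule abs_continuous_curve_imp_continuous_on)
  have contc: "continuous_on UNIV \<gamma>c"
    unfolding \<gamma>c_def using ab
    by (intro continuous_on_fst continuous_on_compose2[OF cont\<gamma>] continuous_intros) auto
  define u where "u k \<tau> = indicator (- N) \<tau> * (norm (\<gamma>c (\<tau> + 1 / real (Suc k)) - \<gamma>c \<tau>) / (1 / real (Suc k)))" for k \<tau>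
  have umeas: "u k \<in> borel_measurable (lebesgue_on {a..b})" for k
  proof -
    have "continuous_on UNIV (\<lambda>\<tau>. norm (\<gamma>c (\<tau> + 1 / real (Suc k)) - \<gamma>c \<tau>) / (1 / real (Suc k)))"
      by (intro continuous_intros continuous_on_compose2[OF contc]) auto
    then have "(\<lambda>\<tau>. norm (\<gamma>c (\<tau> + 1 / real (Suc k)) - \<gamma>c \<tau>) / (1 / real (Suc k))) \<in> borel_measurable lebesgue"
      by (intro measurable_completion) (simp add: borel_measurable_continuous_onI)
    moreover have "- N \<in> sets lebesgue"
      using sets.compl_sets[OF null_setsD2[OF Nnull]] by (simp add: Compl_eq_Diff_UNIV)
    ultimately have "u k \<in> borel_measurable lebesgue"
      unfolding u_def by (intro borel_measurable_times borel_measurable_indicator) auto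
    then show ?thesis by (rule measurable_restrict_space1)
  qed
  have ulim: "(\<lambda>k. u k \<tau>) \<longlonglongrightarrow> M \<tau>" if \<tau>: "\<tau> \<in> {a..b}" for \<tau>
  proof (cases "\<tau> \<in> N")
    case True
    then show ?thesis by (simp add: u_def M_def)
  next
    case False
    then have \<tau>N: "\<tau> \<in> {a..b} - N" and \<tau>b: "\<tau> < b" using \<tau> by (auto simp: N_def less_eq_real_def)
    define hk where "hk k = 1 / real (Suc k)" for k
    have hk0: "hk \<longlonglongrightarrow> 0" unfolding hk_def by (rule LIMSEQ_Suc[OF lim_1_over_n, unfolded of_nat_Suc[symmetric]])
    then have hkat: "filterlim hk (at 0) sequentially"
      by (auto simp: filterlim_at hk_def)
    have "((\<lambda>h. norm (\<gamma> (\<tau> + h) - \<gamma> \<tau> - h *\<^sub>R V \<tau>) / norm h) \<longlongrightarrow> 0) (at 0)"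
      using good(1)[OF \<tau>N] unfolding has_vector_derivative_def has_derivative_at by simp
    then have lim0: "(\<lambda>k. norm (\<gamma> (\<tau> + hk k) - \<gamma> \<tau> - hk k *\<^sub>R V \<tau>) / norm (hk k)) \<longlonglongrightarrow> 0"
      by (rule filterlim_compose[OF _ hkat])
    have ev: "\<forall>\<^sub>F k in sequentially. hk k < b - \<tau>"
      using order_tendstoD(2)[OF hk0, of "b - \<tau>"] \<tau>b by simp
    have "(\<lambda>k. u k \<tau> - M \<tau>) \<longlonglongrightarrow> 0"
    proof (rule Lim_null_comparison[OF _ lim0])
      show "\<forall>\<^sub>F k in sequentially. norm (u k \<tau> - M \<tau>) \<le> norm (\<gamma> (\<tau> + hk k) - \<gamma> \<tau> - hk k *\<^sub>R V \<tau>) / norm (hk k)"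
        using ev
      proof eventually_elim
        case (elim k)
        have hpos: "0 < hk k" by (simp add: hk_def)
        have "u k \<tau> = norm (fst (\<gamma> (\<tau> + hk k) - \<gamma> \<tau>)) / hk k"
          using False \<tau> elim hpos unfolding u_def hk_def[symmetric] \<gamma>c_def by (simp add: max_def min_def)
        moreover have "M \<tau> = norm (fst (hk k *\<^sub>R V \<tau>)) / hk k"
          using \<tau>N hpos by (simp add: M_def)
        ultimately have "norm (u k \<tau> - M \<tau>) = \<bar>norm (fst (\<gamma> (\<tau> + hk k) - \<gamma> \<tau>)) - norm (fst (hk k *\<^sub>R V \<tau>))\<bar> / hk k"
          using hpos by (simp add: diff_divide_distrib[symmetric] del: fst_scaleR norm_scaleR)
        also have "\<dots> \<le> norm (fst (\<gamma> (\<tau> + hk k) - \<gamma> \<tau>) - fst (hk k *\<^sub>R V \<tau>)) / hk k"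
          using hpos by (intro divide_right_mono norm_triangle_ineq3) auto
        also have "\<dots> = norm (fst (\<gamma> (\<tau> + hk k) - \<gamma> \<tau> - hk k *\<^sub>R V \<tau>)) / hk k"
          by simp
        also have "\<dots> \<le> norm (\<gamma> (\<tau> + hk k) - \<gamma> \<tau> - hk k *\<^sub>R V \<tau>) / hk k"
          using hpos dist_fst_le[of "\<gamma> (\<tau> + hk k) - \<gamma> \<tau> - hk k *\<^sub>R V \<tau>" 0]
          by (intro divide_right_mono) (auto simp: dist_norm)
        finally show ?case using hpos by simp
      qed
    qed
    then show ?thesis by (simp add: LIM_zero_iff)
  qed
  have Mmeas: "M \<in> borel_measurable (lebesgue_on {a..b})"
    by (rule borel_measurable_LIMSEQ_real[where u = u, OF _ umeas]) (use ulim in auto)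
  have "AE \<tau> in lebesgue. \<tau> \<notin> N" using Nnull by (rule AE_not_in)
  then have AEeq: "AE \<tau> in lebesgue_on {a..b}. ennreal (riem_norm (\<gamma> \<tau>) (vector_derivative \<gamma> (at \<tau>))) = ennreal (M \<tau>)"
    by (subst AE_restrict_space_iff)
      (auto elim!: eventually_mono simp: M_def V_def[symmetric] good riem_norm_horizontal)
  have nnM: "(\<integral>\<^sup>+ \<tau>. ennreal (M \<tau>) \<partial>lebesgue_on {a..b}) = riem_length a b \<gamma>"
    unfolding riem_length_def by (rule nn_integral_cong_AE[OF AEeq, symmetric])
  have Mint: "integrable (lebesgue_on {a..b}) M"
    using len by (intro integrableI_nonneg[OF Mmeas]) (auto simp: M0 nnM less_top[symmetric])
  have Mion: "M integrable_on {a..b}" using Mint by (rule integrable_on_lebesgue_on) simp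
  have "ennreal (integral {a..b} M) = riem_length a b \<gamma>"
    using nn_integral_eq_integral[OF Mint] lebesgue_integral_eq_integral[OF Mint] M0 nnM by simp
  then have lenL: "integral {a..b} M < L"
    using len by (metis M0 Mion ennreal_less_iff integral_nonneg)
  \<comment> \<open>The unspent length \<open>L - integral {a..b} M\<close> is spread evenly over
    the interval, which gives \<open>\<sigma> b = L\<close> exactly.\<close>
  define \<eta> where "\<eta> = (L - integral {a..b} M) / (b - a)"
  have \<eta>: "0 < \<eta>" using lenL ab by (simp add: \<eta>_def)
  define \<sigma> where "\<sigma> \<tau> = integral {a..\<tau>} M + \<eta> * (\<tau> - a)" for \<tau>
  have sub: "M integrable_on {x..y}" if "a \<le> x" "y \<le> b" for x y
    by (rule integrable_on_subinterval[OF Mion]) (use that in auto)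
  have incr: "\<sigma> y - \<sigma> x = integral {x..y} M + \<eta> * (y - x)" if "a \<le> x" "x < y" "y \<le> b" for x y
    using Henstock_Kurzweil_Integration.integral_combine[of a x y M] that sub[of a y] by (simp add: \<sigma>_def algebra_simps)
  have Jn: "0 \<le> integral {x..y} M" if "a \<le> x" "y \<le> b" for x y
    using sub[OF that] M0 by (simp add: integral_nonneg)
  have zinc: "norm (fst (\<gamma> y) - fst (\<gamma> x)) \<le> integral {x..y} M" if "a \<le> x" "x \<le> y" "y \<le> b" for x y
  proof (rule ac_increment_le_integral[where f = "\<lambda>\<tau>. fst (\<gamma> \<tau>)", OF _ that N])
    show "abs_continuous_curve a b (\<lambda>\<tau>. fst (\<gamma> \<tau>))"
      by (rule abs_continuous_curve_lipschitz_compose[OF ac, of 1]) (auto simp: lipschitz_on_def dist_fst_le)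
    show "(M has_integral integral {x..y} M) {x..y}" using sub that by (simp add: integrable_integral)
    fix \<tau> assume \<tau>: "\<tau> \<in> {x..y} - N"
    then have \<tau>': "\<tau> \<in> {a..b} - N" using that by auto
    then have "((\<lambda>\<tau>. fst (\<gamma> \<tau>)) has_vector_derivative fst (V \<tau>)) (at \<tau>)"
      by (intro bounded_linear.has_vector_derivative[OF bounded_linear_fst] good)
    then show "\<exists>v. ((\<lambda>\<tau>. fst (\<gamma> \<tau>)) has_vector_derivative v) (at \<tau> within {x..y}) \<and> norm v \<le> M \<tau>"
      using \<tau>' by (intro exI[of _ "fst (V \<tau>)"]) (auto simp: M_def intro: has_vector_derivative_at_within)
  qed (rule M0)
  have tinc: "\<bar>snd (\<gamma> y) - snd (\<gamma> x) - 2 * im_form (fst (\<gamma> x)) (fst (\<gamma> y))\<bar> \<le> 2 * (integral {x..y} M)\<^sup>2"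
    if "a \<le> x" "x \<le> y" "y \<le> b" for x y
  proof -
    define J where "J = integral {x..y} M"
    \<comment> \<open>Up to an additive constant, \<open>g\<close> is the third coordinate as seen
      from \<open>\<gamma> x\<close>. Along the curve its derivative is twice \<open>im_form\<close>
      of displacement and velocity, and the displacement is at most \<open>J\<close>.\<close>
    define g where "g p = snd p - 2 * im_form (fst (\<gamma> x)) (fst p)" for p :: "'n heis"
    have "linear g" by (rule linearI) (simp_all add: g_def im_form_simps algebra_simps)
    then have bl: "bounded_linear g" by (simp add: linear_conv_bounded_linear)
    then obtain C where C: "C-lipschitz_on UNIV g"
      by (rule bounded_linear.lipschitz_boundE)
    have "norm (g (\<gamma> y) - g (\<gamma> x)) \<le> 2 * J * J"
    proof (rule ac_increment_le_integral[where f = "\<lambda>\<tau>. g (\<gamma> \<tau>)" and M = "\<lambda>\<tau>. 2 * J * M \<tau>", OF _ that N])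
      show "abs_continuous_curve a b (\<lambda>\<tau>. g (\<gamma> \<tau>))"
        by (rule abs_continuous_curve_lipschitz_compose[OF ac C])
      show "((\<lambda>\<tau>. 2 * J * M \<tau>) has_integral 2 * J * J) {x..y}"
        unfolding J_def using sub that by (intro has_integral_mult_right integrable_integral) auto
      show "0 \<le> 2 * J * M \<tau>" for \<tau> using Jn[of x y] that M0 by (simp add: J_def)
      fix \<tau> assume \<tau>: "\<tau> \<in> {x..y} - N"
      then have \<tau>': "\<tau> \<in> {a..b} - N" using that by auto
      have "((\<lambda>\<tau>. g (\<gamma> \<tau>)) has_vector_derivative g (V \<tau>)) (at \<tau>)"
        using \<tau>' by (intro bounded_linear.has_vector_derivative[OF bl] good)
      moreover have "norm (g (V \<tau>)) \<le> 2 * J * M \<tau>"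
      proof -
        have "g (V \<tau>) = 2 * im_form (fst (\<gamma> \<tau>) - fst (\<gamma> x)) (fst (V \<tau>))"
          using good(2)[OF \<tau>'] by (simp add: T_coeff_eq_0_iff_horizontal T_coeff_def g_def im_form_simps)
        then have "norm (g (V \<tau>)) \<le> 2 * (norm (fst (\<gamma> \<tau>) - fst (\<gamma> x)) * norm (fst (V \<tau>)))"
          using abs_im_form_le[of "fst (\<gamma> \<tau>) - fst (\<gamma> x)" "fst (V \<tau>)"] by simp
        also have "\<dots> \<le> 2 * (J * norm (fst (V \<tau>)))"
        proof -
          have "norm (fst (\<gamma> \<tau>) - fst (\<gamma> x)) \<le> integral {x..\<tau>} M"
            using zinc[of x \<tau>] that \<tau> by simp
          also have "\<dots> \<le> J"
            using Henstock_Kurzweil_Integration.integral_combine[of x \<tau> y M] sub[of x y] Jn[of \<tau> y] that \<tau>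
            by (simp add: J_def)
          finally show ?thesis by (simp add: mult_right_mono)
        qed
        finally show ?thesis using \<tau>' by (simp add: M_def)
      qed
      ultimately show "\<exists>v. ((\<lambda>\<tau>. g (\<gamma> \<tau>)) has_vector_derivative v) (at \<tau> within {x..y}) \<and> norm v \<le> 2 * J * M \<tau>"
        using has_vector_derivative_at_within by blast
    qed
    then show ?thesis
      by (simp add: g_def J_def power2_eq_square algebra_simps)
  qed
  show ?thesis
  proof (rule that)
    show "continuous_on {a..b} \<sigma>"
      unfolding \<sigma>_def using Mion by (intro continuous_intros indefinite_integral_continuous_1)
    show "\<sigma> a = 0" by (simp add: \<sigma>_def)
    show "\<sigma> b = L" using ab by (simp add: \<sigma>_def \<eta>_def)
    fix x y assume xy: "a \<le> x" "x < y" "y \<le> b"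
    have J: "0 \<le> integral {x..y} M" "integral {x..y} M \<le> \<sigma> y - \<sigma> x"
      using Jn xy incr[OF xy] \<eta> by auto
    have "0 < \<eta> * (y - x)" using \<eta> xy by simp
    then show "\<sigma> x < \<sigma> y" using incr[OF xy] J(1) by linarith
    show "norm (fst (\<gamma> y) - fst (\<gamma> x)) \<le> \<sigma> y - \<sigma> x" using zinc[of x y] xy J by simp
    have "2 * (integral {x..y} M)\<^sup>2 \<le> 2 * (\<sigma> y - \<sigma> x)\<^sup>2" using J by (simp add: power_mono)
    then show "\<bar>snd (\<gamma> y) - snd (\<gamma> x) - 2 * im_form (fst (\<gamma> x)) (fst (\<gamma> y))\<bar> \<le> 2 * (\<sigma> y - \<sigma> x)\<^sup>2"
      using tinc[of x y] xy by simp
  qed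
qed

text \<open>The parameter interval is open because the totalised \<open>cot pi\<close> is 0:
  including \<open>pi\<close> would impose \<open>pi * |s| <= L^2\<close> everywhere, which some
  points of the ball off the axis violate. On the axis that bound returns as the limit of
  \<open>k\<close> to \<open>pi\<close>.\<close>

definition cc_region :: "real \<Rightarrow> 'n::finite heis set" where
  "cc_region L = {(w, s). \<forall>k\<in>{0<..<pi}. k * cot k * (norm w)\<^sup>2 + k * \<bar>s\<bar> \<le> L\<^sup>2}"

text \<open>\<open>p\<^sup>-\<^sup>1 \<cdot> q\<close>\<close>

definition heis_diff :: "'n::finite heis \<Rightarrow> 'n heis \<Rightarrow> 'n heis" where
  "heis_diff p q = (fst q - fst p, snd q - snd p - 2 * im_form (fst p) (fst q))"

lemma curve_imp_cc_region:
  fixes \<gamma> :: "real \<Rightarrow> 'n::finite heis"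
  assumes hc: "horizontal_curve a b \<gamma>" and ab: "a \<le> b" and len: "riem_length a b \<gamma> < ennreal L"
  shows "heis_diff (\<gamma> a) (\<gamma> b) \<in> cc_region L"
proof -
  define w s where "w = fst (\<gamma> b) - fst (\<gamma> a)" and "s = snd (\<gamma> b) - snd (\<gamma> a) - 2 * im_form (fst (\<gamma> a)) (fst (\<gamma> b))"
  have L: "0 < L" using len by (metis ennreal_neg leI not_less_zero)
  have "k * cot k * (norm w)\<^sup>2 + k * \<bar>s\<bar> \<le> L\<^sup>2" if k: "k \<in> {0<..<pi}" for k
  proof (cases "a = b")
    case True
    then show ?thesis by (simp add: w_def s_def)
  next
    case False
    then have "a < b" using ab by simp
    then obtain \<sigma> where \<sigma>: "continuous_on {a..b} \<sigma>" "\<sigma> a = 0" "\<sigma> b = L"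
      "\<And>x y. a \<le> x \<Longrightarrow> x < y \<Longrightarrow> y \<le> b \<Longrightarrow> \<sigma> x < \<sigma> y"
      "\<And>x y. a \<le> x \<Longrightarrow> x < y \<Longrightarrow> y \<le> b \<Longrightarrow> norm (fst (\<gamma> y) - fst (\<gamma> x)) \<le> \<sigma> y - \<sigma> x"
      "\<And>x y. a \<le> x \<Longrightarrow> x < y \<Longrightarrow> y \<le> b \<Longrightarrow>
        \<bar>snd (\<gamma> y) - snd (\<gamma> x) - 2 * im_form (fst (\<gamma> x)) (fst (\<gamma> y))\<bar> \<le> 2 * (\<sigma> y - \<sigma> x)\<^sup>2"
      using horizontal_curve_arclength[OF hc _ len] by blast
    \<comment> \<open>With \<open>c = k / L\<close> the total angle
      \<open>c * (\<sigma> b - \<sigma> a)\<close> equals \<open>k\<close>.\<close>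
    have "k / L * cot (k / L * (\<sigma> b - \<sigma> a)) * (norm (fst (\<gamma> b) - fst (\<gamma> a)))\<^sup>2 +
      k / L * \<bar>snd (\<gamma> b) - snd (\<gamma> a) - 2 * im_form (fst (\<gamma> a)) (fst (\<gamma> b))\<bar> \<le> \<sigma> b - \<sigma> a"
      using \<open>a < b\<close> \<sigma>(1,4,5,6) by (rule cot_calibration) (use k L \<sigma>(2,3) in auto)
    then have "(k * cot k * (norm w)\<^sup>2 + k * \<bar>s\<bar>) / L \<le> L"
      using \<sigma>(2,3) L by (simp add: w_def s_def add_divide_distrib)
    then show ?thesis using L by (simp add: pos_divide_le_eq power2_eq_square)
  qed
  then show ?thesis by (simp add: cc_region_def heis_diff_def w_def s_def)
qed

text \<open>The distance is only an infimum: each \<open>L' > L\<close> exceeds the length of some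
  curve, and the constraints, being closed conditions, survive the limit of \<open>L'\<close> to
  \<open>L\<close>.\<close>

lemma cc_dist_le_imp_cc_region:
  assumes "cc_dist p q \<le> ennreal L" "0 \<le> L"
  shows "heis_diff p q \<in> cc_region L"
proof -
  define w s where "w = fst (heis_diff p q)" and "s = snd (heis_diff p q)"
  have "k * cot k * (norm w)\<^sup>2 + k * \<bar>s\<bar> \<le> L\<^sup>2" if k: "k \<in> {0<..<pi}" for k
  proof -
    have "k * cot k * (norm w)\<^sup>2 + k * \<bar>s\<bar> \<le> L'\<^sup>2" if "L < L'" for L'
    proof -
      have "cc_dist p q < ennreal L'" using assms that by (metis ennreal_less_iff le_less_trans)
      then obtain a b \<gamma> where "riem_length a b \<gamma> < ennreal L'" "a \<le> b" "horizontal_curve a b \<gamma>" "\<gamma> a = p" "\<gamma> b = q"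
        unfolding cc_dist_def Inf_less_iff by blast
      then have "heis_diff p q \<in> cc_region L'" using curve_imp_cc_region by blast
      then show ?thesis using k by (auto simp: cc_region_def w_def s_def)
    qed
    then have "\<forall>\<^sub>F L' in at_right L. k * cot k * (norm w)\<^sup>2 + k * \<bar>s\<bar> \<le> L'\<^sup>2"
      by (auto simp: eventually_at_right_less intro: eventually_mono[OF eventually_at_right_less])
    moreover have "((\<lambda>L'. L'\<^sup>2) \<longlongrightarrow> L\<^sup>2) (at_right L)" by (intro tendsto_intros)
    ultimately show ?thesis by (intro tendsto_lowerbound) auto
  qed
  then show ?thesis by (auto simp: cc_region_def w_def s_def case_prod_beta')
qed

section \<open>Upper bound for the distance\<close>

lemma heis_mult_heis_diff: "heis_mult p (heis_diff p q) = q"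
  by (simp add: heis_mult_def heis_diff_def im_form_simps)

lemma lipschitz_heis_mult_left: "\<exists>C. C-lipschitz_on UNIV (heis_mult p)"
proof -
  define D where "D u = (fst u, snd u + 2 * im_form (fst p) (fst u))" for u
  have "linear D" by (rule linearI) (simp_all add: D_def im_form_simps algebra_simps)
  then have "bounded_linear D" by (simp add: linear_conv_bounded_linear)
  then obtain C where "C-lipschitz_on UNIV D" by (rule bounded_linear.lipschitz_boundE)
  moreover have "heis_mult p = (\<lambda>q. p + D q)" by (auto simp: heis_mult_def D_def prod_eq_iff)
  ultimately have "C-lipschitz_on UNIV (heis_mult p)" by (simp add: lipschitz_on_def)
  then show ?thesis ..
qed

text \<open>The differential \<open>D\<close> of a left translation preserves the
  \<open>complex ^ 'n\<close> component of a vector and its \<open>T_coeff\<close>, hence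
  horizontality and speed.\<close>

lemma horizontal_curve_left_translate:
  fixes \<gamma> :: "real \<Rightarrow> 'n::finite heis"
  assumes hc: "horizontal_curve a b \<gamma>"
  shows "horizontal_curve a b (\<lambda>\<tau>. heis_mult p (\<gamma> \<tau>))"
    and "riem_length a b (\<lambda>\<tau>. heis_mult p (\<gamma> \<tau>)) = riem_length a b \<gamma>"
proof -
  define D where "D u = (fst u, snd u + 2 * im_form (fst p) (fst u))" for u
  have der: "((\<lambda>\<tau>. heis_mult p (\<gamma> \<tau>)) has_vector_derivative D v) (at \<tau>)"
    if "(\<gamma> has_vector_derivative v) (at \<tau>)" for \<tau> v
  proof -
    have "(heis_mult p has_derivative D) (at (\<gamma> \<tau>))"
      unfolding D_def by (rule has_derivative_heis_mult_left)
    then have "(heis_mult p \<circ> \<gamma> has_derivative D \<circ> (\<lambda>h. h *\<^sub>R v)) (at \<tau>)"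
      using that unfolding has_vector_derivative_def by (intro diff_chain_at)
    moreover have "D \<circ> (\<lambda>h. h *\<^sub>R v) = (\<lambda>h. h *\<^sub>R D v)"
      by (auto simp: D_def im_form_simps algebra_simps)
    ultimately show ?thesis by (simp add: has_vector_derivative_def o_def)
  qed
  have hor: "D v \<in> horizontal_space (heis_mult p q)" if "v \<in> horizontal_space q" for q v
    using that by (simp add: T_coeff_eq_0_iff_horizontal T_coeff_def D_def heis_mult_def im_form_simps)
  have ae: "AE \<tau> in lebesgue_on {a..b}. \<exists>v \<in> horizontal_space (\<gamma> \<tau>). (\<gamma> has_vector_derivative v) (at \<tau>)"
    using hc by (simp add: horizontal_curve_def)
  obtain C where C: "C-lipschitz_on UNIV (heis_mult p)" using lipschitz_heis_mult_left by blast
  have "abs_continuous_curve a b (\<lambda>\<tau>. heis_mult p (\<gamma> \<tau>))"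
    by (rule abs_continuous_curve_lipschitz_compose[OF _ C]) (use hc in \<open>simp add: horizontal_curve_def\<close>)
  then show "horizontal_curve a b (\<lambda>\<tau>. heis_mult p (\<gamma> \<tau>))"
    unfolding horizontal_curve_def using ae by (auto elim!: eventually_mono intro: der hor)
  have "AE \<tau> in lebesgue_on {a..b}.
     ennreal (riem_norm (heis_mult p (\<gamma> \<tau>)) (vector_derivative (\<lambda>\<tau>. heis_mult p (\<gamma> \<tau>)) (at \<tau>)))
     = ennreal (riem_norm (\<gamma> \<tau>) (vector_derivative \<gamma> (at \<tau>)))"
    using ae
  proof eventually_elim
    case (elim \<tau>)
    then obtain v where v: "v \<in> horizontal_space (\<gamma> \<tau>)" "(\<gamma> has_vector_derivative v) (at \<tau>)" by blast
    then have "vector_derivative \<gamma> (at \<tau>) = v"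
      "vector_derivative (\<lambda>\<tau>. heis_mult p (\<gamma> \<tau>)) (at \<tau>) = D v"
      by (auto intro!: vector_derivative_at der)
    then show ?case using v(1) hor[OF v(1)] by (simp add: riem_norm_horizontal) (simp add: D_def)
  qed
  then show "riem_length a b (\<lambda>\<tau>. heis_mult p (\<gamma> \<tau>)) = riem_length a b \<gamma>"
    unfolding riem_length_def by (rule nn_integral_cong_AE)
qed

text \<open>Carries upper bounds from the origin to an arbitrary base point; the lower bounds are
  proved for arbitrary end points directly.\<close>

lemma cc_dist_left_translate_le: "cc_dist (heis_mult g p) (heis_mult g q) \<le> cc_dist p q"
  unfolding cc_dist_def
proof (rule Inf_mono, clarify)
  fix a b :: real and \<gamma> :: "real \<Rightarrow> 'a heis"
  assume h: "a \<le> b" "horizontal_curve a b \<gamma>" "p = \<gamma> a" "q = \<gamma> b"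
  show "\<exists>x\<in>{riem_length a' b' \<gamma>' |a' b' \<gamma>'. a' \<le> b' \<and> horizontal_curve a' b' \<gamma>' \<and>
        \<gamma>' a' = heis_mult g (\<gamma> a) \<and> \<gamma>' b' = heis_mult g (\<gamma> b)}. x \<le> riem_length a b \<gamma>"
  proof (rule bexI[of _ "riem_length a b \<gamma>"])
    show "riem_length a b \<gamma> \<in> {riem_length a' b' \<gamma>' |a' b' \<gamma>'. a' \<le> b' \<and> horizontal_curve a' b' \<gamma>' \<and>
        \<gamma>' a' = heis_mult g (\<gamma> a) \<and> \<gamma>' b' = heis_mult g (\<gamma> b)}"
      unfolding mem_Collect_eq
      by (rule exI[of _ a], rule exI[of _ b], rule exI[of _ "\<lambda>\<tau>. heis_mult g (\<gamma> \<tau>)"])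
        (simp add: horizontal_curve_left_translate[OF h(2)] h(1))
  qed simp
qed

text \<open>\<open>K\<close> is the speed of the projection and becomes the length; \<open>B\<close>
  bounds the full velocity and makes the curve Lipschitz, hence absolutely continuous.\<close>

lemma cc_dist_le_constant_speed:
  fixes \<gamma> :: "real \<Rightarrow> 'n::finite heis"
  assumes der: "\<And>\<tau>. (\<gamma> has_vector_derivative v \<tau>) (at \<tau>)"
    and hor: "\<And>\<tau>. v \<tau> \<in> horizontal_space (\<gamma> \<tau>)"
    and speed: "\<And>\<tau>. norm (fst (v \<tau>)) = K" and bd: "\<And>\<tau>. norm (v \<tau>) \<le> B"
  shows "cc_dist (\<gamma> 0) (\<gamma> 1) \<le> ennreal K"
proof -
  have K: "0 \<le> K" using speed[of 0] norm_ge_zero by metis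
  have B: "0 \<le> B" using bd[of 0] norm_ge_zero order_trans by blast
  have "B-lipschitz_on {0..1} \<gamma>"
  proof (rule bounded_derivative_imp_lipschitz[where f' = "\<lambda>\<tau> h. h *\<^sub>R v \<tau>"])
    show "(\<gamma> has_derivative (\<lambda>h. h *\<^sub>R v \<tau>)) (at \<tau> within {0..1})" for \<tau>
      using der[of \<tau>] unfolding has_vector_derivative_def by (rule has_derivative_at_withinI)
    show "onorm (\<lambda>h. h *\<^sub>R v \<tau>) \<le> B" for \<tau>
      using bd[of \<tau>] by (intro onorm_le) (simp add: mult.commute[of B] mult_left_mono)
  qed (use B in auto)
  then have hc: "horizontal_curve 0 1 \<gamma>"
    unfolding horizontal_curve_def using der hor by (auto intro: lipschitz_imp_abs_continuous_curve)
  have "riem_length 0 1 \<gamma> = (\<integral>\<^sup>+ \<tau>. ennreal K \<partial>lebesgue_on {0..1::real})"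
    unfolding riem_length_def
    by (intro nn_integral_cong) (simp add: vector_derivative_at[OF der] riem_norm_horizontal[OF hor] speed)
  also have "\<dots> = ennreal K" by (simp add: emeasure_restrict_space)
  finally have "riem_length 0 1 \<gamma> = ennreal K" .
  then have "ennreal K \<in> {riem_length a b \<gamma>' |a b \<gamma>'. a \<le> b \<and> horizontal_curve a b \<gamma>' \<and> \<gamma>' a = \<gamma> 0 \<and> \<gamma>' b = \<gamma> 1}"
    unfolding mem_Collect_eq using hc
    by (intro exI[of _ "0::real"] exI[of _ "1::real"] exI[of _ \<gamma>]) auto
  then show ?thesis
    unfolding cc_dist_def by (rule Inf_lower)
qed

lemma cc_dist_segment: "cc_dist (0, 0) (w, 0) \<le> ennreal (norm w)"
proof -
  have "cc_dist (0 *\<^sub>R w, 0) (1 *\<^sub>R w, 0) \<le> ennreal (norm w)"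
  proof (rule cc_dist_le_constant_speed[where \<gamma> = "\<lambda>\<tau>. (\<tau> *\<^sub>R w, 0)" and v = "\<lambda>_. (w, 0)" and B = "norm w"])
    show "((\<lambda>\<tau>. (\<tau> *\<^sub>R w, 0)) has_vector_derivative (w, 0)) (at \<tau>)" for \<tau>
      by (auto intro!: derivative_eq_intros)
  qed (auto simp: T_coeff_eq_0_iff_horizontal T_coeff_def im_form_simps norm_Pair)
  then show ?thesis by simp
qed

text \<open>On the complex line through \<open>u\<close> the form is that of the plane, scaled;
  circular arcs are thereby reduced to dimension one.\<close>

lemma im_form_mult_vec:
  fixes u :: "complex ^ 'n::finite"
  shows "im_form (\<chi> j. a * u $ j) (\<chi> j. b * u $ j) = Im (a * cnj b) * (norm u)\<^sup>2"
proof -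
  have "(norm u)\<^sup>2 = (\<Sum>j\<in>UNIV. (norm (u $ j))\<^sup>2)"
    by (simp add: norm_vec_def L2_set_def sum_nonneg)
  moreover have "Im (a * u $ j * cnj (b * u $ j)) = Im (a * cnj b) * (norm (u $ j))\<^sup>2" for j
  proof -
    have *: "a * u $ j * cnj (b * u $ j) = (a * cnj b) * complex_of_real ((norm (u $ j))\<^sup>2)"
      unfolding complex_norm_square by simp
    show ?thesis unfolding * by (simp add: algebra_simps)
  qed
  ultimately show ?thesis by (simp add: im_form_def sum_distrib_left)
qed

text \<open>The curve is the horizontal lift of an arc through the origin of the circle with centre
  \<open>- u\<close>. Its third coordinate is -4 times the signed area between arc and chord, the
  sign being dictated by the group law.\<close>

lemma cc_dist_arc:
  fixes u :: "complex ^ 'n::finite"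
  shows "cc_dist (0, 0) ((\<chi> j. (cis \<theta> - 1) * u $ j), - 2 * (norm u)\<^sup>2 * (\<theta> - sin \<theta>)) \<le> ennreal (\<bar>\<theta>\<bar> * norm u)"
proof -
  define \<gamma> where "\<gamma> \<tau> = ((\<chi> j. (cis (\<theta> * \<tau>) - 1) * u $ j), - 2 * (norm u)\<^sup>2 * (\<theta> * \<tau> - sin (\<theta> * \<tau>)))" for \<tau>
  define v where "v \<tau> = ((\<chi> j. (\<i> * of_real \<theta> * cis (\<theta> * \<tau>)) * u $ j), - 2 * (norm u)\<^sup>2 * (\<theta> - \<theta> * cos (\<theta> * \<tau>)))" for \<tau>
  have "cc_dist (\<gamma> 0) (\<gamma> 1) \<le> ennreal (\<bar>\<theta>\<bar> * norm u)"
  proof (rule cc_dist_le_constant_speed[where v = v and B = "\<bar>\<theta>\<bar> * norm u + 4 * (norm u)\<^sup>2 * \<bar>\<theta>\<bar>"])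
    fix \<tau>
    have bl: "bounded_linear (\<lambda>c. (\<chi> j. c * u $ j) :: complex ^ 'n)"
      unfolding linear_conv_bounded_linear[symmetric]
      by (rule linearI) (simp_all add: vec_eq_iff algebra_simps)
    have "((\<lambda>\<tau>. of_real (cos (\<theta> * \<tau>)) + \<i> * of_real (sin (\<theta> * \<tau>)) - 1) has_vector_derivative
        (of_real (- (sin (\<theta> * \<tau>) * \<theta>)) + \<i> * of_real (cos (\<theta> * \<tau>) * \<theta>) - 0)) (at \<tau>)"
      by (intro has_vector_derivative_add has_vector_derivative_diff has_vector_derivative_mult_right
          has_vector_derivative_of_real has_vector_derivative_const) (auto intro!: derivative_eq_intros)
    moreover have "cis x = of_real (cos x) + \<i> * of_real (sin x)" for x
      by (simp add: complex_eq_iff)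
    ultimately have "((\<lambda>\<tau>. cis (\<theta> * \<tau>) - 1) has_vector_derivative \<i> * of_real \<theta> * cis (\<theta> * \<tau>)) (at \<tau>)"
      by (simp add: algebra_simps)
    from bounded_linear.has_vector_derivative[OF bl this]
    show "(\<gamma> has_vector_derivative v \<tau>) (at \<tau>)"
      unfolding \<gamma>_def v_def
      by (intro has_vector_derivative_Pair)
        (auto intro!: derivative_eq_intros simp: has_real_derivative_iff_has_vector_derivative[symmetric] algebra_simps)
    have "im_form (fst (\<gamma> \<tau>)) (fst (v \<tau>)) = Im ((cis (\<theta> * \<tau>) - 1) * cnj (\<i> * of_real \<theta> * cis (\<theta> * \<tau>))) * (norm u)\<^sup>2"
      by (simp only: \<gamma>_def v_def fst_conv im_form_mult_vec)
    also have "Im ((cis (\<theta> * \<tau>) - 1) * cnj (\<i> * of_real \<theta> * cis (\<theta> * \<tau>))) = - \<theta> * (1 - cos (\<theta> * \<tau>))"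
    proof -
      have "cos (\<theta> * \<tau>) * cos (\<theta> * \<tau>) + sin (\<theta> * \<tau>) * sin (\<theta> * \<tau>) = 1"
        using sin_cos_squared_add3 .
      then have "\<theta> * (cos (\<theta> * \<tau>) * cos (\<theta> * \<tau>) + sin (\<theta> * \<tau>) * sin (\<theta> * \<tau>)) = \<theta>" by simp
      then show ?thesis by (simp add: algebra_simps)
    qed
    finally show "v \<tau> \<in> horizontal_space (\<gamma> \<tau>)"
      by (simp add: T_coeff_eq_0_iff_horizontal T_coeff_def) (simp add: v_def algebra_simps)
    show sp: "norm (fst (v \<tau>)) = \<bar>\<theta>\<bar> * norm u"
      by (simp add: v_def norm_mult_vec norm_mult)
    have "\<bar>snd (v \<tau>)\<bar> = 2 * (norm u)\<^sup>2 * (\<bar>\<theta>\<bar> * \<bar>1 - cos (\<theta> * \<tau>)\<bar>)"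
      by (simp add: v_def abs_mult right_diff_distrib[of \<theta> 1, simplified, symmetric] del: right_diff_distrib)
    also have "\<dots> \<le> 2 * (norm u)\<^sup>2 * (\<bar>\<theta>\<bar> * 2)"
      using cos_ge_minus_one[of "\<theta> * \<tau>"] cos_le_one[of "\<theta> * \<tau>"]
      by (intro mult_left_mono) auto
    finally have "norm (snd (v \<tau>)) \<le> 4 * (norm u)\<^sup>2 * \<bar>\<theta>\<bar>" by simp
    moreover have "norm (v \<tau>) \<le> norm (fst (v \<tau>)) + norm (snd (v \<tau>))"
      using norm_Pair_le[of "fst (v \<tau>)" "snd (v \<tau>)"] by simp
    ultimately show "norm (v \<tau>) \<le> \<bar>\<theta>\<bar> * norm u + 4 * (norm u)\<^sup>2 * \<bar>\<theta>\<bar>"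
      using sp by simp
  qed
  moreover have "\<gamma> 0 = (0, 0)" "\<gamma> 1 = ((\<chi> j. (cis \<theta> - 1) * u $ j), - 2 * (norm u)\<^sup>2 * (\<theta> - sin \<theta>))"
    by (simp_all add: \<gamma>_def vec_eq_iff)
  ultimately show ?thesis by metis
qed

section \<open>Reaching a given point by an arc\<close>

lemma norm_cis_minus_1: "norm (cis t - 1) = 2 * \<bar>sin (t / 2)\<bar>"
  using dist_exp_i_1[of t] by (simp add: cis_conv_exp)

text \<open>As \<open>k\<close> tends to 0 the factor \<open>k * cot k\<close> tends to 1. The
  smaller factor \<open>cos k\<close> has the same limit and is continuous at 0.\<close>

lemma cc_region_fst_le:
  assumes "(w, s) \<in> cc_region L" "0 \<le> L"
  shows "norm w \<le> L"
proof -
  have "cos k * (norm w)\<^sup>2 \<le> L\<^sup>2" if k: "k \<in> {0<..<pi/2}" for k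
  proof -
    have "0 < sin k" "sin k \<le> k" "0 \<le> cos k" using k by (auto intro!: sin_gt_zero sin_x_le_x cos_ge_zero)
    then have "cos k \<le> k * cot k" using mult_right_mono[of "sin k" k "cos k"] by (simp add: cot_def field_simps)
    then have "cos k * (norm w)\<^sup>2 \<le> k * cot k * (norm w)\<^sup>2" by (rule mult_right_mono) simp
    also have "\<dots> \<le> k * cot k * (norm w)\<^sup>2 + k * \<bar>s\<bar>" using k by simp
    also have "\<dots> \<le> L\<^sup>2" using assms(1) k unfolding cc_region_def by auto
    finally show ?thesis .
  qed
  then have "\<forall>\<^sub>F k in at_right 0. cos k * (norm w)\<^sup>2 \<le> L\<^sup>2"
    by (intro eventually_at_rightI[of 0 "pi/2"]) auto
  moreover have "((\<lambda>k. cos k * (norm w)\<^sup>2) \<longlongrightarrow> cos 0 * (norm w)\<^sup>2) (at_right 0)"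
    by (intro tendsto_intros)
  ultimately have "cos 0 * (norm w)\<^sup>2 \<le> L\<^sup>2" by (intro tendsto_upperbound) auto
  then show ?thesis using assms(2) by (simp add: power2_le_iff_abs_le)
qed

text \<open>Determines the half-angle of the arc ending at a point with
  \<open>|s| / (norm w)^2 = v\<close>. The quotient of the two sides tends to 0 at 0; clearing the
  denominator makes the function \<open>F\<close> continuous up to \<open>pi\<close>, where it is
  positive.\<close>

lemma exists_arc_angle:
  assumes "0 < (v::real)"
  obtains \<phi> where "0 < \<phi>" "\<phi> < pi" "\<phi> - sin \<phi> * cos \<phi> = v * (sin \<phi>)\<^sup>2"
proof -
  define F where "F \<phi> = \<phi> - sin \<phi> * cos \<phi> - v * (sin \<phi>)\<^sup>2" for \<phi> :: real
  have "((\<lambda>\<phi>::real. (\<phi> - sin \<phi> * cos \<phi>) / (sin \<phi>)\<^sup>2) \<longlongrightarrow> 0) (at_right 0)"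
    by real_asymp
  then have "\<forall>\<^sub>F \<phi> in at_right 0. (\<phi> - sin \<phi> * cos \<phi>) / (sin \<phi>)\<^sup>2 < v"
    using assms by (rule order_tendstoD)
  moreover have "\<forall>\<^sub>F \<phi> in at_right (0::real). \<phi> \<in> {0<..<pi}"
    by (rule eventually_at_right_real) simp
  ultimately have "\<forall>\<^sub>F \<phi> in at_right (0::real). \<phi> \<in> {0<..<pi} \<and> (\<phi> - sin \<phi> * cos \<phi>) / (sin \<phi>)\<^sup>2 < v"
    by eventually_elim auto
  then obtain a where a: "a \<in> {0<..<pi}" "(a - sin a * cos a) / (sin a)\<^sup>2 < v"
    using eventually_happens[of _ "at_right (0::real)"] by force
  have "F a < 0"
    using a sin_gt_zero[of a] by (simp add: F_def pos_divide_less_eq)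
  moreover have "F pi = pi" by (simp add: F_def)
  ultimately obtain \<phi> where \<phi>: "a \<le> \<phi>" "\<phi> \<le> pi" "F \<phi> = 0"
    using IVT'[of F a 0 pi] a by (force simp: F_def intro!: continuous_intros)
  moreover have "\<phi> \<noteq> pi" using \<phi> \<open>F pi = pi\<close> by auto
  ultimately show ?thesis using a by (intro that[of \<phi>]) (auto simp: F_def)
qed

lemma cc_dist_arc_endpoint:
  fixes w :: "complex ^ 'n::finite"
  assumes \<phi>: "0 < \<phi>" "\<phi> < pi" and \<epsilon>: "\<bar>\<epsilon>\<bar> = 1"
    and s: "s = \<epsilon> * ((norm w)\<^sup>2 * (\<phi> - sin \<phi> * cos \<phi>) / (sin \<phi>)\<^sup>2)"
  shows "cc_dist (0, 0) (w, s) \<le> ennreal (\<phi> * norm w / sin \<phi>)"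
proof -
  have sp: "0 < sin \<phi>" using \<phi> by (intro sin_gt_zero)
  have \<epsilon>': "\<epsilon> = 1 \<or> \<epsilon> = -1" using \<epsilon> by linarith
  \<comment> \<open>A positive rotation lowers the third coordinate, so the angle has the sign
    opposite to \<open>\<epsilon>\<close>; \<open>u\<close> is then solved for from the end point
    \<open>w\<close>.\<close>
  define \<theta> where "\<theta> = - (2 * \<phi> * \<epsilon>)"
  define u :: "complex ^ 'n" where "u = (\<chi> j. inverse (cis \<theta> - 1) * w $ j)"
  have nc: "norm (cis \<theta> - 1) = 2 * sin \<phi>"
    using \<epsilon>' sp by (auto simp: norm_cis_minus_1 \<theta>_def)
  then have cn: "cis \<theta> - 1 \<noteq> 0" using sp by auto
  have nu: "norm u = norm w / (2 * sin \<phi>)"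
    unfolding u_def norm_mult_vec norm_inverse nc by (simp add: field_simps)
  have "(\<chi> j. (cis \<theta> - 1) * u $ j) = w" using cn by (simp add: u_def vec_eq_iff)
  moreover have "- 2 * (norm u)\<^sup>2 * (\<theta> - sin \<theta>) = s"
  proof -
    have *: "\<theta> - sin \<theta> = - \<epsilon> * (2 * (\<phi> - sin \<phi> * cos \<phi>))"
      using \<epsilon>' by (auto simp: \<theta>_def sin_double)
    have "- 2 * (x / (2 * y))\<^sup>2 * (- \<epsilon> * (2 * A)) = \<epsilon> * (x\<^sup>2 * A / y\<^sup>2)" for x y A :: real
      by (simp add: power_divide power_mult_distrib)
    then show ?thesis
      unfolding nu s * .
  qed
  moreover have "\<bar>\<theta>\<bar> * norm u = \<phi> * norm w / sin \<phi>"
    unfolding nu using \<phi> \<epsilon> by (simp add: \<theta>_def abs_mult)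
  ultimately show ?thesis
    using cc_dist_arc[of \<theta> u] by metis
qed

text \<open>If \<open>s\<close> and \<open>w\<close> are nonzero, the constraint at the half-angle
  of the arc ending at the point says that the squared length of that arc is at most
  \<open>L^2\<close>. The limiting half-angles 0 and \<open>pi\<close> give the segment for
  \<open>s = 0\<close> and the full circle for \<open>w = 0\<close>.\<close>

lemma cc_region_imp_cc_dist_le:
  fixes w :: "complex ^ 'n::finite"
  assumes reg: "(w, s) \<in> cc_region L" and L: "0 \<le> L"
  shows "cc_dist (0, 0) (w, s) \<le> ennreal L"
proof -
  have R: "k * cot k * (norm w)\<^sup>2 + k * \<bar>s\<bar> \<le> L\<^sup>2" if "0 < k" "k < pi" for k
    using reg that by (auto simp: cc_region_def)
  consider "s = 0" | "s \<noteq> 0" "w = 0" | "s \<noteq> 0" "w \<noteq> 0" by auto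
  then show ?thesis
  proof cases
    case 1
    then show ?thesis
      using cc_dist_segment[of w] ennreal_leI[OF cc_region_fst_le[OF reg L]] by (meson order_trans)
  next
    case 2
    define \<theta> where "\<theta> = - (2 * pi * sgn s)"
    \<comment> \<open>A full turn of radius \<open>r\<close> reaches height
      \<open>4 * pi * r^2\<close>. The direction of \<open>u\<close> is arbitrary,
      \<open>undefined\<close> being just some index.\<close>
    define u :: "complex ^ 'n" where "u = sqrt (\<bar>s\<bar> / (4 * pi)) *\<^sub>R axis undefined 1"
    have nu: "(norm u)\<^sup>2 = \<bar>s\<bar> / (4 * pi)" by (simp add: u_def)
    have \<theta>: "cis \<theta> = 1" "sin \<theta> = 0" using 2 by (auto simp: \<theta>_def sgn_real_def complex_eq_iff)
    have "- 2 * (norm u)\<^sup>2 * (\<theta> - sin \<theta>) = s"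
      unfolding nu \<theta> by (simp add: \<theta>_def sgn_real_def)
    moreover have "(\<chi> j. (cis \<theta> - 1) * u $ j) = w" using 2 by (simp add: \<theta> vec_eq_iff)
    moreover have "\<bar>\<theta>\<bar> * norm u \<le> L"
    proof (rule power2_le_imp_le)
      have "pi * \<bar>s\<bar> \<le> L\<^sup>2"
      proof (rule ccontr)
        assume "\<not> ?thesis"
        then have "L\<^sup>2 / \<bar>s\<bar> < pi" using 2 by (simp add: field_simps)
        then obtain k where k: "L\<^sup>2 / \<bar>s\<bar> < k" "k < pi" using dense by blast
        moreover have "0 \<le> L\<^sup>2 / \<bar>s\<bar>" by simp
        ultimately have "0 < k" by linarith
        then show False using R[of k] k 2 by (simp add: field_simps)
      qed
      then show "(\<bar>\<theta>\<bar> * norm u)\<^sup>2 \<le> L\<^sup>2"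
        unfolding power_mult_distrib nu using 2
        by (simp add: \<theta>_def abs_mult abs_sgn_eq power_mult_distrib) (simp add: power2_eq_square)
    qed (use L in auto)
    ultimately show ?thesis
      using cc_dist_arc[of \<theta> u] ennreal_leI by (metis order_trans)
  next
    case 3
    then have "0 < \<bar>s\<bar> / (norm w)\<^sup>2" by simp
    then obtain \<phi> where \<phi>: "0 < \<phi>" "\<phi> < pi" "\<phi> - sin \<phi> * cos \<phi> = \<bar>s\<bar> / (norm w)\<^sup>2 * (sin \<phi>)\<^sup>2"
      by (rule exists_arc_angle)
    have sp: "0 < sin \<phi>" using \<phi> by (intro sin_gt_zero)
    have sw: "\<bar>s\<bar> = (norm w)\<^sup>2 * (\<phi> - sin \<phi> * cos \<phi>) / (sin \<phi>)\<^sup>2"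
      using \<phi>(3) 3 sp by (simp add: field_simps)
    have "cc_dist (0, 0) (w, s) \<le> ennreal (\<phi> * norm w / sin \<phi>)"
      using \<phi>(1,2) by (rule cc_dist_arc_endpoint[where \<epsilon> = "sgn s"])
        (use 3 in \<open>simp_all add: sw[symmetric] sgn_mult_abs abs_sgn_eq\<close>)
    also have "\<phi> * norm w / sin \<phi> \<le> L"
    proof (rule power2_le_imp_le)
      have "(\<phi> * norm w / sin \<phi>)\<^sup>2 = \<phi> * cot \<phi> * (norm w)\<^sup>2 + \<phi> * \<bar>s\<bar>"
        unfolding sw using sp by (simp add: cot_def field_simps power2_eq_square)
      also have "\<dots> \<le> L\<^sup>2" using \<phi> by (intro R)
      finally show "(\<phi> * norm w / sin \<phi>)\<^sup>2 \<le> L\<^sup>2" .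
    qed (use L in auto)
    finally show ?thesis by (simp add: ennreal_leI)
  qed
qed

lemma cc_dist_le_iff_cc_region:
  assumes "0 \<le> L"
  shows "cc_dist p q \<le> ennreal L \<longleftrightarrow> heis_diff p q \<in> cc_region L"
proof
  assume h: "heis_diff p q \<in> cc_region L"
  have "cc_dist p q = cc_dist (heis_mult p (0, 0)) (heis_mult p (heis_diff p q))"
    by (simp only: heis_mult_heis_diff) (simp add: heis_mult_def)
  also have "\<dots> \<le> cc_dist (0, 0) (heis_diff p q)" by (rule cc_dist_left_translate_le)
  also have "\<dots> \<le> ennreal L"
    using cc_region_imp_cc_dist_le[of "fst (heis_diff p q)" "snd (heis_diff p q)" L] h assms by simp
  finally show "cc_dist p q \<le> ennreal L" .
qed (use cc_dist_le_imp_cc_region assms in blast)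

section \<open>The profile of the ball\<close>

lemma isCont_rho: "isCont rho x"
proof (cases "x = 0")
  case True
  have "((\<lambda>x::real. sin x / x) \<longlongrightarrow> 1) (at 0)" by real_asymp
  moreover have "\<forall>\<^sub>F x in at 0. rho x = sin x / x"
    by (auto simp: eventually_at_filter rho_def)
  ultimately have "(rho \<longlongrightarrow> 1) (at 0)" by (simp add: tendsto_cong)
  then show ?thesis using True by (simp add: isCont_def rho_def)
next
  case False
  have "\<forall>\<^sub>F y in nhds x. y \<in> - {0}" using False by (intro eventually_nhds_in_open) auto
  then have "\<forall>\<^sub>F y in nhds x. rho y = sin y / y" by eventually_elim (simp add: rho_def)
  then show ?thesis using False by (subst isCont_cong) (auto intro!: continuous_intros)
qed

lemma rho_strict_decreasing:
  assumes "0 \<le> x" "x < y" "y \<le> pi"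
  shows "rho y < rho x"
proof (rule DERIV_neg_imp_decreasing_open[OF assms(2)])
  show "continuous_on {x..y} rho" by (simp add: continuous_at_imp_continuous_on isCont_rho)
  fix t assume t: "x < t" "t < y"
  then have t': "0 < t" "t < pi" using assms by auto
  have der: "((\<lambda>u. sin u / u) has_real_derivative ((cos t * t - sin t) / (t * t))) (at t)"
    using t' by (auto intro!: derivative_eq_intros)
  have "\<forall>\<^sub>F u in nhds t. u \<in> - {0}" using t' by (intro eventually_nhds_in_open) auto
  then have ev: "\<forall>\<^sub>F u in nhds t. rho u = sin u / u" by eventually_elim (simp add: rho_def)
  have "(rho has_real_derivative ((cos t * t - sin t) / (t * t))) (at t)"
    using der by (subst DERIV_cong_ev[OF refl ev refl])
  moreover have "(cos t * t - sin t) / (t * t) < 0"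
    using x_cos_less_sin[OF t'] t' by (intro divide_neg_pos) (auto simp: mult.commute)
  ultimately show "\<exists>D. (rho has_real_derivative D) (at t) \<and> D < 0" by blast
qed

lemma inj_on_rho: "inj_on rho {0..pi}"
  by (rule linorder_inj_onI) (use rho_strict_decreasing in fastforce)+

lemma rho_half_pi: "rho (pi / 2) = 2 / pi"
  by (simp add: rho_def)

text \<open>On the ball branch of \<open>l_profile\<close> the rescaled radius is at least
  \<open>2 / pi\<close>, which corresponds to angles up to \<open>pi / 2\<close>.\<close>

lemma rho_surj:
  assumes "2 / pi \<le> s" "s \<le> 1"
  obtains \<phi> where "0 \<le> \<phi>" "\<phi> \<le> pi / 2" "rho \<phi> = s"
proof -
  have "\<exists>\<phi>\<ge>0. \<phi> \<le> pi / 2 \<and> rho \<phi> = s"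
    by (rule IVT2') (use assms in \<open>auto simp: rho_half_pi continuous_at_imp_continuous_on isCont_rho rho_def[of 0]\<close>)
  then show ?thesis using that by blast
qed

text \<open>Parametrising the radius by the angle removes the inverse of \<open>rho\<close> from the
  profile.\<close>

lemma h_scaled_rho:
  assumes "0 < \<mu>" "0 \<le> \<phi>" "\<phi> \<le> pi"
  shows "h_scaled \<mu> (\<mu> * rho \<phi>) = \<mu>\<^sup>2 * g_fun \<phi>"
  using assms by (simp add: h_scaled_def h_fun_def the_inv_into_f_f[OF inj_on_rho])

lemma cc_region_mono_snd:
  assumes "(w, s) \<in> cc_region L" "\<bar>s'\<bar> \<le> \<bar>s\<bar>"
  shows "(w, s') \<in> cc_region L"
proof -
  have "k * cot k * (norm w)\<^sup>2 + k * \<bar>s'\<bar> \<le> L\<^sup>2" if "0 < k" "k < pi" for k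
  proof -
    have "k * \<bar>s'\<bar> \<le> k * \<bar>s\<bar>" using assms(2) that by simp
    moreover have "k * cot k * (norm w)\<^sup>2 + k * \<bar>s\<bar> \<le> L\<^sup>2" using assms(1) that by (auto simp: cc_region_def)
    ultimately show ?thesis by linarith
  qed
  then show ?thesis by (auto simp: cc_region_def)
qed

text \<open>The bound on \<open>|s|\<close> is the constraint \<open>k = \<phi>\<close>, or its
  limit if \<open>\<phi> = 0\<close>. Conversely, for \<open>\<phi> > 0\<close>, the point at height
  \<open>\<mu>^2 * g_fun \<phi>\<close> is the end of an arc of length \<open>\<mu>\<close>, so the
  lower bound for the distance yields all its constraints at once, without any maximisation over
  \<open>k\<close>.\<close>

lemma cc_region_iff_profile:
  fixes w :: "complex ^ 'n::finite"
  assumes \<mu>: "0 < \<mu>" and \<phi>: "0 \<le> \<phi>" "\<phi> < pi" and w: "norm w = \<mu> * rho \<phi>"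
  shows "(w, s) \<in> cc_region \<mu> \<longleftrightarrow> \<bar>s\<bar> \<le> \<mu>\<^sup>2 * g_fun \<phi>"
proof (cases "\<phi> = 0")
  case True
  then have nw: "norm w = \<mu>" using w by (simp add: rho_def)
  show ?thesis
  proof
    assume reg: "(w, s) \<in> cc_region \<mu>"
    have "\<bar>s\<bar> \<le> \<mu>\<^sup>2 * ((1 - k * (cos k / sin k)) / k)" if k: "k \<in> {0<..<pi}" for k
    proof -
      have "k * cot k * (norm w)\<^sup>2 + k * \<bar>s\<bar> \<le> \<mu>\<^sup>2" using reg k unfolding cc_region_def by auto
      then have "\<bar>s\<bar> * k \<le> \<mu>\<^sup>2 - k * cot k * \<mu>\<^sup>2" by (simp add: nw mult.commute)
      then have "\<bar>s\<bar> \<le> (\<mu>\<^sup>2 - k * cot k * \<mu>\<^sup>2) / k" using k by (simp add: pos_le_divide_eq)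
      also have "\<dots> = \<mu>\<^sup>2 * ((1 - k * (cos k / sin k)) / k)" by (simp add: cot_def right_diff_distrib)
      finally show ?thesis .
    qed
    then have "\<forall>\<^sub>F k in at_right 0. \<bar>s\<bar> \<le> \<mu>\<^sup>2 * ((1 - k * (cos k / sin k)) / k)"
      by (intro eventually_at_rightI[of 0 pi]) auto
    moreover have "((\<lambda>k::real. (1 - k * (cos k / sin k)) / k) \<longlongrightarrow> 0) (at_right 0)" by real_asymp
    then have "((\<lambda>k. \<mu>\<^sup>2 * ((1 - k * (cos k / sin k)) / k)) \<longlongrightarrow> \<mu>\<^sup>2 * 0) (at_right 0)" by (rule tendsto_mult_left)
    ultimately have "\<bar>s\<bar> \<le> \<mu>\<^sup>2 * 0" by (intro tendsto_lowerbound) auto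
    then show "\<bar>s\<bar> \<le> \<mu>\<^sup>2 * g_fun \<phi>" using True by (simp add: g_fun_def)
  next
    assume "\<bar>s\<bar> \<le> \<mu>\<^sup>2 * g_fun \<phi>"
    then have "s = 0" using True by (simp add: g_fun_def)
    moreover have "k * cot k * \<mu>\<^sup>2 \<le> \<mu>\<^sup>2" if "0 < k" "k < pi" for k
    proof -
      have "k * cot k \<le> k * (1 / k)" using cot_le_inverse[OF that] that by (intro mult_left_mono) auto
      then have "k * cot k * \<mu>\<^sup>2 \<le> 1 * \<mu>\<^sup>2" using that by (intro mult_right_mono) auto
      then show ?thesis by simp
    qed
    ultimately show "(w, s) \<in> cc_region \<mu>" by (auto simp: cc_region_def nw)
  qed
next
  case False
  then have \<phi>0: "0 < \<phi>" using \<phi> by simp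
  have sp: "0 < sin \<phi>" using \<phi>0 \<phi> by (intro sin_gt_zero)
  have nw: "norm w = \<mu> * (sin \<phi> / \<phi>)" using w False by (simp add: rho_def)
  have g: "g_fun \<phi> = (\<phi> - sin \<phi> * cos \<phi>) / \<phi>\<^sup>2" using False by (simp add: g_fun_def sin_double diff_divide_distrib)
  have mg: "\<mu>\<^sup>2 * g_fun \<phi> = (norm w)\<^sup>2 * (\<phi> - sin \<phi> * cos \<phi>) / (sin \<phi>)\<^sup>2"
    unfolding g nw using sp \<phi>0 by (simp add: power_mult_distrib power_divide)
  show ?thesis
  proof
    assume "(w, s) \<in> cc_region \<mu>"
    then have "\<phi> * cot \<phi> * (norm w)\<^sup>2 + \<phi> * \<bar>s\<bar> \<le> \<mu>\<^sup>2" using \<phi>0 \<phi> by (auto simp: cc_region_def)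
    moreover have "\<phi> * cot \<phi> * (norm w)\<^sup>2 = \<mu>\<^sup>2 * (sin \<phi> * cos \<phi> / \<phi>)"
      unfolding nw using sp \<phi>0 by (simp add: cot_def power2_eq_square)
    ultimately have "\<phi> * \<bar>s\<bar> \<le> \<mu>\<^sup>2 * (1 - sin \<phi> * cos \<phi> / \<phi>)" by (simp add: right_diff_distrib)
    also have "\<dots> = \<phi> * (\<mu>\<^sup>2 * g_fun \<phi>)"
      unfolding g using \<phi>0 by (simp add: field_simps power2_eq_square)
    finally show "\<bar>s\<bar> \<le> \<mu>\<^sup>2 * g_fun \<phi>" using \<phi>0 by simp
  next
    assume s: "\<bar>s\<bar> \<le> \<mu>\<^sup>2 * g_fun \<phi>"
    have "cc_dist (0, 0) (w, \<mu>\<^sup>2 * g_fun \<phi>) \<le> ennreal (\<phi> * norm w / sin \<phi>)"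
      using \<phi>0 \<phi>(2) by (rule cc_dist_arc_endpoint[where \<epsilon> = 1]) (simp_all add: mg)
    also have "\<phi> * norm w / sin \<phi> = \<mu>" using sp \<phi>0 by (simp add: nw)
    finally have "heis_diff (0, 0) (w, \<mu>\<^sup>2 * g_fun \<phi>) \<in> cc_region \<mu>"
      using \<mu> by (intro cc_dist_le_imp_cc_region) auto
    then have "(w, \<mu>\<^sup>2 * g_fun \<phi>) \<in> cc_region \<mu>" by (simp add: heis_diff_def)
    then show "(w, s) \<in> cc_region \<mu>" by (rule cc_region_mono_snd) (use s in simp)
  qed
qed

section \<open>The unperturbed set and the volume\<close>

lemma mem_A2_set_iff:
  assumes "0 < lam"
  shows "(z, t) \<in> A2_set lam \<longleftrightarrow> (z, t) \<in> cc_region (lam / 2) \<and> lam / pi \<le> norm z"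
  using assms cc_dist_le_iff_cc_region[of "lam / 2" "(0, 0)" "(z, t)"]
  by (simp add: A2_set_def cc_cball_def heis_diff_def)

text \<open>At this radius the angle is \<open>pi / 2\<close> and the ball is exactly as high as the
  cylinder, so the two pieces of the set fit together.\<close>

lemma profile_at_inner_radius:
  fixes z :: "complex ^ 'n::finite"
  assumes "0 < lam" "norm z = lam / pi"
  shows "(z, t) \<in> cc_region (lam / 2) \<longleftrightarrow> \<bar>t\<bar> \<le> lam\<^sup>2 / (2 * pi)"
proof -
  have "(z, t) \<in> cc_region (lam / 2) \<longleftrightarrow> \<bar>t\<bar> \<le> (lam / 2)\<^sup>2 * g_fun (pi / 2)"
    using assms by (intro cc_region_iff_profile) (auto simp: rho_half_pi)
  moreover have "(lam / 2)\<^sup>2 * g_fun (pi / 2) = lam\<^sup>2 / (2 * pi)"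
    by (simp add: g_fun_def field_simps power2_eq_square)
  ultimately show ?thesis by simp
qed

text \<open>Puts \<open>A_set\<close> into the perturbed family, so that one computation of the
  diameter serves both sets. The sphere \<open>norm z = lam / pi\<close> belongs to both pieces and
  is settled by the agreement of their heights.\<close>

lemma A_set_eq_A_pert_0:
  assumes lam: "0 < lam"
  shows "A_set lam = A_pert lam (\<lambda>_. 0 :: real)"
proof -
  have cyl: "2 * pi * \<bar>t\<bar> \<le> lam\<^sup>2 \<longleftrightarrow> \<bar>t\<bar> \<le> lam\<^sup>2 / (2 * pi)" for t :: real
    by (simp add: field_simps)
  have "(z, t) \<in> A_set lam \<longleftrightarrow> (z, t) \<in> A_pert lam (\<lambda>_. 0)" for z :: "complex ^ 'n" and t
  proof (cases "norm z \<le> lam / pi")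
    case True
    have "lam * 2 \<le> lam * pi" using lam pi_ge_two by (intro mult_left_mono) auto
    then have "lam / pi \<le> lam / 2" using lam by (simp add: field_simps)
    then have "2 * norm z \<le> lam" using True by linarith
    moreover have "(z, t) \<in> A2_set lam \<Longrightarrow> \<bar>t\<bar> \<le> lam\<^sup>2 / (2 * pi)"
      using True lam profile_at_inner_radius[of lam z t] by (simp add: mem_A2_set_iff)
    ultimately show ?thesis
      using True by (auto simp: A_set_def A_pert_def l_profile_def cyl)
  next
    case False
    have "(z, t) \<in> A_set lam \<longleftrightarrow> (z, t) \<in> cc_region (lam / 2)"
    proof (cases "norm z \<le> lam / 2")
      case True
      define s where "s = norm z / (lam / 2)"
      have "2 / pi \<le> s" "s \<le> 1" using False True lam by (auto simp: s_def field_simps)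
      then obtain \<phi> where \<phi>: "0 \<le> \<phi>" "\<phi> \<le> pi / 2" "rho \<phi> = s" by (rule rho_surj)
      have \<phi>': "\<phi> < pi" using \<phi> pi_gt_zero by linarith
      have nz: "norm z = lam / 2 * rho \<phi>" using \<phi> lam by (simp add: s_def)
      have "h_scaled (lam / 2) (norm z) = (lam / 2)\<^sup>2 * g_fun \<phi>"
        unfolding nz using lam \<phi> \<phi>' by (intro h_scaled_rho) auto
      moreover have "(z, t) \<in> A_set lam \<longleftrightarrow> \<bar>t\<bar> \<le> h_scaled (lam / 2) (norm z)"
        using False True by (simp add: A_set_def l_profile_def)
      moreover have "(z, t) \<in> cc_region (lam / 2) \<longleftrightarrow> \<bar>t\<bar> \<le> (lam / 2)\<^sup>2 * g_fun \<phi>"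
        by (rule cc_region_iff_profile[OF _ \<phi>(1) \<phi>' nz]) (use lam in simp)
      ultimately show ?thesis by simp
    next
      case nz: False
      then have "(z, t) \<notin> cc_region (lam / 2)" using cc_region_fst_le[of z t "lam / 2"] lam by auto
      then show ?thesis using nz by (auto simp: A_set_def)
    qed
    then show ?thesis using False lam by (auto simp: A_pert_def mem_A2_set_iff)
  qed
  then show ?thesis by auto
qed

text \<open>Supplies the Borel measurability that slicing requires.\<close>

lemma closed_A_pert:
  assumes lam: "0 < lam" and f: "continuous_on UNIV f"
  shows "closed (A_pert lam f)"
proof -
  have "closed (cc_region L :: 'n::finite heis set)" for L
  proof -
    have eq: "cc_region L = (\<Inter>k\<in>{0<..<pi}. {p :: 'n heis. k * cot k * (norm (fst p))\<^sup>2 + k * \<bar>snd p\<bar> \<le> L\<^sup>2})"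
      by (auto simp: cc_region_def)
    show ?thesis unfolding eq by (intro closed_INT ballI closed_Collect_le continuous_intros)
  qed
  moreover have "A_pert lam f = ({p. norm (fst p) \<le> lam / pi} \<inter> {p. 2 * pi * \<bar>snd p - f (fst p)\<bar> \<le> lam\<^sup>2})
      \<union> (cc_region (lam / 2) \<inter> {p. lam / pi \<le> norm (fst p)})"
    using lam by (auto simp: A_pert_def mem_A2_set_iff)
  moreover have "continuous_on UNIV (\<lambda>p :: 'a heis. f (fst p))"
    by (rule continuous_on_compose2[OF f]) (auto intro: continuous_intros)
  ultimately show ?thesis
    by (auto intro!: closed_Un closed_Int closed_Collect_le continuous_intros)
qed

lemma emeasure_A_pert:
  fixes f :: "complex ^ 'n::finite \<Rightarrow> real"
  assumes lam: "0 < lam" and f: "continuous_on UNIV f" and supp: "\<And>z. lam / pi \<le> norm z \<Longrightarrow> f z = 0"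
  shows "emeasure lebesgue (A_pert lam f) = emeasure lebesgue (A_pert lam (\<lambda>_. 0) :: 'n heis set)"
proof -
  have fub: "emeasure lebesgue (A_pert lam g) = (\<integral>\<^sup>+z. emeasure lborel (Pair z -` A_pert lam g) \<partial>lborel)"
    if "continuous_on UNIV g" for g :: "complex ^ 'n \<Rightarrow> real"
  proof -
    have meas: "A_pert lam g \<in> sets borel" using closed_A_pert[OF lam that] by (rule borel_closed)
    then have "emeasure lebesgue (A_pert lam g) = emeasure (lborel \<Otimes>\<^sub>M lborel) (A_pert lam g)"
      unfolding lborel_prod by simp
    also have "\<dots> = (\<integral>\<^sup>+z. emeasure lborel (Pair z -` A_pert lam g) \<partial>lborel)"
      by (rule lborel.emeasure_pair_measure_alt) (use meas in \<open>simp only: lborel_prod sets_lborel\<close>)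
    finally show ?thesis .
  qed
  have slice: "emeasure lborel (Pair z -` A_pert lam f) = emeasure lborel (Pair z -` A_pert lam (\<lambda>_. 0))" for z
  proof (cases "lam / pi \<le> norm z")
    \<comment> \<open>At radius exactly \<open>lam / pi\<close> the cylinder contributes to the
      slice too; as \<open>f\<close> vanishes there, the two slices coincide.\<close>
    case True
    then show ?thesis using supp by (simp add: A_pert_def)
  next
    case False
    define K where "K = lam\<^sup>2 / (2 * pi)"
    have "Pair z -` A_pert lam g = {g z - K..g z + K}" for g
    proof -
      have "2 * pi * \<bar>t - g z\<bar> \<le> lam\<^sup>2 \<longleftrightarrow> \<bar>t - g z\<bar> \<le> K" for t
        unfolding K_def by (simp add: field_simps)
      then have "t \<in> Pair z -` A_pert lam g \<longleftrightarrow> \<bar>t - g z\<bar> \<le> K" for t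
        using False by (simp add: A_pert_def A2_set_def)
      moreover have "\<bar>t - g z\<bar> \<le> K \<longleftrightarrow> t \<in> {g z - K..g z + K}" for t by auto
      ultimately show ?thesis by blast
    qed
    moreover have "0 \<le> K" by (simp add: K_def)
    ultimately show ?thesis by simp
  qed
  show ?thesis unfolding fub[OF f] fub[OF continuous_on_const] slice ..
qed

section \<open>The diameter of the perturbed set\<close>

text \<open>Subadditivity applied to \<open>- z\<close> and \<open>z'\<close> with equal angles
  \<open>c\<close>. Doubled, the conclusion is the constraint with parameter \<open>2 * c\<close>
  for radius \<open>2 * \<mu>\<close>.\<close>

lemma diameter_bound_of_half_bounds:
  fixes z z' :: "complex ^ 'n::finite"
  assumes c: "0 < c" "c < pi / 2"
    and p: "c * cot c * (norm z)\<^sup>2 + c * \<bar>t\<bar> \<le> \<mu>\<^sup>2"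
    and q: "c * cot c * (norm z')\<^sup>2 + c * \<bar>t'\<bar> \<le> \<mu>\<^sup>2"
  shows "c * cot (2 * c) * (norm (z' - z))\<^sup>2 + c * \<bar>t' - t - 2 * im_form z z'\<bar> \<le> 2 * \<mu>\<^sup>2"
proof -
  have "cot (c + c) * (norm (- z + z'))\<^sup>2 + 2 * \<bar>im_form (- z) z'\<bar> \<le> cot c * (norm (- z))\<^sup>2 + cot c * (norm z')\<^sup>2"
    using c by (intro cot_form_subadditive) auto
  then have "cot (2 * c) * (norm (z' - z))\<^sup>2 + 2 * \<bar>im_form z z'\<bar> \<le> cot c * (norm z)\<^sup>2 + cot c * (norm z')\<^sup>2"
    unfolding mult_2[of c, symmetric] by (simp add: im_form_minus_left)
  moreover have "\<bar>t' - t - 2 * im_form z z'\<bar> \<le> \<bar>t'\<bar> + \<bar>t\<bar> + 2 * \<bar>im_form z z'\<bar>"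
    by linarith
  ultimately have "cot (2 * c) * (norm (z' - z))\<^sup>2 + \<bar>t' - t - 2 * im_form z z'\<bar>
      \<le> cot c * (norm z)\<^sup>2 + \<bar>t\<bar> + (cot c * (norm z')\<^sup>2 + \<bar>t'\<bar>)"
    by linarith
  then have "c * (cot (2 * c) * (norm (z' - z))\<^sup>2 + \<bar>t' - t - 2 * im_form z z'\<bar>)
      \<le> c * (cot c * (norm z)\<^sup>2 + \<bar>t\<bar> + (cot c * (norm z')\<^sup>2 + \<bar>t'\<bar>))"
    using c by (intro mult_left_mono) auto
  then show ?thesis using p q by (simp add: distrib_left mult.assoc)
qed

text \<open>For \<open>c\<close> near \<open>pi / 2\<close> the bound on heights alone is critical, but then \<open>cot (2 * c)\<close> is very
  negative and absorbs a perturbation that is linear in \<open>norm w\<close>.\<close>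

lemma diameter_bound_near_axis:
  fixes w :: "complex ^ 'n::finite"
  assumes c: "pi / 3 \<le> c" "c < pi / 2" and \<mu>: "0 \<le> \<mu>"
    and s: "\<bar>s\<bar> \<le> 4 * \<mu>\<^sup>2 / pi + 3 / 10 * \<mu> * norm w"
  shows "c * cot (2 * c) * (norm w)\<^sup>2 + c * \<bar>s\<bar> \<le> 2 * \<mu>\<^sup>2"
proof -
  define e where "e = pi / 2 - c"
  have e: "0 < e" "e \<le> pi / 6" and ce: "c = pi / 2 - e" using c by (auto simp: e_def)
  have c0: "0 < c" using c pi_gt_zero by linarith
  \<comment> \<open>The assumption \<open>pi / 3 \<le> c\<close> enters here: it keeps the cosine
    away from 0.\<close>
  have "1 / 2 \<le> cos (2 * e)"
    using cos_monotone_0_pi_le[of "2 * e" "pi / 3"] e by (simp add: cos_60)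
  moreover have sp: "0 < sin (2 * e)" "sin (2 * e) \<le> 2 * e"
    using e pi_gt_zero by (auto intro!: sin_gt_zero sin_x_le_x)
  ultimately have "(1 / 2) / (2 * e) \<le> cos (2 * e) / sin (2 * e)"
    by (intro frac_le) auto
  moreover have "cot (2 * c) = - (cos (2 * e) / sin (2 * e))"
    by (simp add: ce cot_def right_diff_distrib)
  ultimately have cot: "cot (2 * c) \<le> - (1 / (4 * e))" by simp
  \<comment> \<open>The weights match the two gains, up to constants: the height term falls short of
    \<open>2 * \<mu>^2\<close> by \<open>4 / pi * (e * \<mu>^2)\<close>, and the cotangent term
    contributes \<open>- c * (norm w)^2 / (4 * e)\<close>.\<close>
  have am: "\<mu> * norm w \<le> e * \<mu>\<^sup>2 + (norm w)\<^sup>2 / (4 * e)"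
  proof -
    have "0 \<le> (2 * e * \<mu> - norm w)\<^sup>2 / (4 * e)" using e by simp
    also have "\<dots> = e * \<mu>\<^sup>2 - \<mu> * norm w + (norm w)\<^sup>2 / (4 * e)"
      using e by (simp add: power2_diff power_mult_distrib add_divide_distrib diff_divide_distrib) (simp add: power2_eq_square)
    finally show ?thesis by simp
  qed
  have k: "3 / 10 * c \<le> 4 / pi"
  proof -
    have "pi * pi \<le> 4 * 4" using pi_less_4 by (intro mult_mono) auto
    moreover have "3 / 10 * c * pi \<le> 3 / 10 * (pi / 2) * pi" using c by (intro mult_right_mono) auto
    moreover have "3 / 10 * (pi / 2) * pi = 3 / 20 * (pi * pi)" by simp
    ultimately have "3 / 10 * c * pi \<le> 4" by linarith
    then show ?thesis by (simp add: pos_le_divide_eq)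
  qed
  have "c * cot (2 * c) * (norm w)\<^sup>2 \<le> c * (- (1 / (4 * e))) * (norm w)\<^sup>2"
    using cot c0 by (intro mult_right_mono mult_left_mono) auto
  then have 1: "c * cot (2 * c) * (norm w)\<^sup>2 \<le> - (c * ((norm w)\<^sup>2 / (4 * e)))" by simp
  have "c * \<bar>s\<bar> \<le> c * (4 * \<mu>\<^sup>2 / pi + 3 / 10 * \<mu> * norm w)"
    using s c0 by (intro mult_left_mono) auto
  also have "\<dots> = 2 * \<mu>\<^sup>2 - 4 / pi * (e * \<mu>\<^sup>2) + 3 / 10 * c * (\<mu> * norm w)"
    by (simp add: ce field_simps)
  also have "3 / 10 * c * (\<mu> * norm w) \<le> 3 / 10 * c * (e * \<mu>\<^sup>2 + (norm w)\<^sup>2 / (4 * e))"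
    using am c0 by (intro mult_left_mono) auto
  also have "\<dots> = 3 / 10 * c * (e * \<mu>\<^sup>2) + 3 / 10 * c * ((norm w)\<^sup>2 / (4 * e))"
    by (rule distrib_left)
  also have "3 / 10 * c * (e * \<mu>\<^sup>2) \<le> 4 / pi * (e * \<mu>\<^sup>2)"
    using k e by (intro mult_right_mono) auto
  also have "3 / 10 * c * ((norm w)\<^sup>2 / (4 * e)) \<le> c * ((norm w)\<^sup>2 / (4 * e))"
    using c0 e by (intro mult_right_mono) auto
  finally show ?thesis using 1 by linarith
qed

text \<open>On the ball piece this is the constraint \<open>k = pi / 2\<close>, whose cotangent term
  vanishes.\<close>

lemma A_pert_height:
  assumes lam: "0 < lam" and mem: "(z, t) \<in> A_pert lam f" and supp: "lam / pi \<le> norm z \<Longrightarrow> f z = 0"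
  shows "\<bar>t - f z\<bar> \<le> lam\<^sup>2 / (2 * pi)"
proof (cases "(z, t) \<in> A2_set lam")
  case True
  then have z: "(z, t) \<in> cc_region (lam / 2)" "lam / pi \<le> norm z" using lam by (auto simp: mem_A2_set_iff)
  have "pi / 2 \<in> {0<..<pi}" by simp
  with z(1) have "pi / 2 * cot (pi / 2) * (norm z)\<^sup>2 + pi / 2 * \<bar>t\<bar> \<le> (lam / 2)\<^sup>2"
    unfolding cc_region_def by blast
  then have "\<bar>t\<bar> \<le> lam\<^sup>2 / (2 * pi)" by (simp add: cot_def field_simps power2_eq_square)
  then show ?thesis using supp z(2) by simp
next
  case False
  then have "2 * pi * \<bar>t - f z\<bar> \<le> lam\<^sup>2" using mem by (simp add: A_pert_def)
  then show ?thesis by (simp add: pos_le_divide_eq mult.commute)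
qed

text \<open>A point of the cylinder is compared with a point of the rim, at radius
  \<open>lam / pi\<close> and maximal height, which lies in the ball. For
  \<open>c \<le> pi / 2\<close> the cotangent is nonnegative, so moving towards the axis cannot
  increase the left-hand side; this is why filling up the poles respects these constraints.\<close>

lemma A_pert_half_bound:
  fixes z :: "complex ^ 'n::finite"
  assumes lam: "0 < lam" and mem: "(z, t) \<in> A_pert lam f" and fz: "f z = 0"
    and c: "0 < c" "c \<le> pi / 2"
  shows "c * cot c * (norm z)\<^sup>2 + c * \<bar>t\<bar> \<le> (lam / 2)\<^sup>2"
proof (cases "(z, t) \<in> A2_set lam")
  case True
  then have "(z, t) \<in> cc_region (lam / 2)" using lam by (simp add: mem_A2_set_iff)
  then show ?thesis using c pi_gt_zero by (auto simp: cc_region_def)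
next
  case False
  define K where "K = lam\<^sup>2 / (2 * pi)"
  have nz: "norm z \<le> lam / pi" and t: "\<bar>t\<bar> \<le> K"
    using False mem fz A_pert_height[OF lam mem] by (auto simp: A_pert_def K_def)
  obtain v :: "complex ^ 'n" where v: "norm v = lam / pi"
    using vector_choose_size[of "lam / pi"] lam by auto
  have "(v, K) \<in> cc_region (lam / 2)"
    using profile_at_inner_radius[OF lam v, of K] by (simp add: K_def)
  then have R: "c * cot c * (norm v)\<^sup>2 + c * \<bar>K\<bar> \<le> (lam / 2)\<^sup>2" using c pi_gt_zero by (auto simp: cc_region_def)
  have "0 \<le> cot c" using c pi_gt_zero by (auto simp: cot_def intro!: divide_nonneg_nonneg cos_ge_zero sin_ge_zero)
  then have "c * cot c * (norm z)\<^sup>2 \<le> c * cot c * (norm v)\<^sup>2"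
    using c nz v by (intro mult_left_mono power_mono) auto
  moreover have "c * \<bar>t\<bar> \<le> c * \<bar>K\<bar>" using t c by (intro mult_left_mono) auto
  ultimately show ?thesis using R by linarith
qed

text \<open>For \<open>c \<le> pi / 3\<close> the unperturbed height contributes at most
  \<open>lam^2 / 6\<close>; the gap to \<open>lam^2 / 4\<close> accommodates both \<open>f\<close>
  and the small radius.\<close>

lemma A_pert_half_bound_near_axis:
  fixes z :: "complex ^ 'n::finite"
  assumes lam: "0 < lam" and t: "\<bar>t - f z\<bar> \<le> lam\<^sup>2 / (2 * pi)"
    and lip: "C-lipschitz_on UNIV f" and C: "C \<le> pi * lam / 80"
    and supp: "\<And>z. lam / 20 \<le> norm z \<Longrightarrow> f z = 0" and nz: "norm z < lam / 20"
    and c: "0 < c" "c \<le> pi / 3"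
  shows "c * cot c * (norm z)\<^sup>2 + c * \<bar>t\<bar> \<le> (lam / 2)\<^sup>2"
proof -
  \<comment> \<open>A step of length \<open>lam / 10\<close> leads from \<open>z\<close> to a zero
    of \<open>f\<close>, so the Lipschitz bound controls \<open>f z\<close> itself.\<close>
  obtain v :: "complex ^ 'n" where v: "norm v = lam / 10"
    using vector_choose_size[of "lam / 10"] lam by auto
  have "lam / 20 \<le> norm (z + v)" using norm_triangle_ineq2[of v "- z"] v nz by (simp add: add.commute)
  then have "f (z + v) = 0" by (rule supp)
  then have "\<bar>f z\<bar> \<le> C * (lam / 10)"
    using lipschitz_onD[OF lip, of z "z + v"] v by (simp add: dist_norm)
  also have "\<dots> \<le> pi * lam / 80 * (lam / 10)" using C lam by (intro mult_right_mono) auto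
  also have "\<dots> \<le> 4 * lam / 80 * (lam / 10)" using pi_less_4 lam by (intro mult_right_mono divide_right_mono) auto
  finally have fz: "\<bar>f z\<bar> \<le> lam\<^sup>2 / 200" by (simp add: power2_eq_square)
  have "\<bar>t\<bar> \<le> lam\<^sup>2 / (2 * pi) + lam\<^sup>2 / 200" using t fz by linarith
  then have "c * \<bar>t\<bar> \<le> pi / 3 * (lam\<^sup>2 / (2 * pi) + lam\<^sup>2 / 200)" using c by (intro mult_mono) auto
  also have "\<dots> = lam\<^sup>2 / 6 + pi * lam\<^sup>2 / 600" by (simp add: distrib_left)
  also have "pi * lam\<^sup>2 / 600 \<le> 4 * lam\<^sup>2 / 600" using pi_less_4 by (intro divide_right_mono mult_right_mono) auto
  finally have ct: "c * \<bar>t\<bar> \<le> lam\<^sup>2 / 6 + 4 * lam\<^sup>2 / 600" by simp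
  have "c * cot c \<le> c * (1 / c)" using cot_le_inverse[of c] c pi_gt_zero by (intro mult_left_mono) auto
  then have "c * cot c * (norm z)\<^sup>2 \<le> 1 * (norm z)\<^sup>2" using c by (intro mult_right_mono) auto
  also have "\<dots> \<le> (lam / 20)\<^sup>2" using nz by (simp add: power_mono)
  also have "\<dots> = lam\<^sup>2 / 400" by (simp add: power_divide)
  finally have "c * cot c * (norm z)\<^sup>2 \<le> lam\<^sup>2 / 400" .
  moreover have "(lam / 2)\<^sup>2 = lam\<^sup>2 / 4" by (simp add: power_divide)
  ultimately show ?thesis using ct zero_le_power2[of lam] by linarith
qed

text \<open>With \<open>c = k / 2\<close>, the half constraints hold at both points if
  \<open>c < pi / 3\<close> or if both are at distance at least \<open>lam / 20\<close> from the
  axis. Otherwise a half constraint can fail, because \<open>f\<close> may raise a point above the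
  critical height, and the difference is estimated directly.\<close>

lemma A_pert_pair_in_cc_region:
  fixes f :: "complex ^ 'n::finite \<Rightarrow> real"
  assumes lam: "0 < lam" and lip: "C-lipschitz_on UNIV f" and C: "C \<le> pi * lam / 80"
    and supp: "\<And>z. lam / 20 \<le> norm z \<Longrightarrow> f z = 0"
    and p: "(z, t) \<in> A_pert lam f" and q: "(z', t') \<in> A_pert lam f"
  shows "(z' - z, t' - t - 2 * im_form z z') \<in> cc_region lam"
proof -
  have pi20: "lam / 20 \<le> lam / pi" using lam pi_less_4 by (intro divide_left_mono) auto
  have supp': "f z = 0" if "lam / pi \<le> norm z" for z using that pi20 supp[of z] by linarith
  have ht: "\<bar>t - f z\<bar> \<le> lam\<^sup>2 / (2 * pi)" and ht': "\<bar>t' - f z'\<bar> \<le> lam\<^sup>2 / (2 * pi)"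
    using A_pert_height[OF lam p supp'] A_pert_height[OF lam q supp'] by auto
  have main: "c * cot (2 * c) * (norm (z' - z))\<^sup>2 + c * \<bar>t' - t - 2 * im_form z z'\<bar> \<le> 2 * (lam / 2)\<^sup>2"
    if c: "0 < c" "c < pi / 2" for c
  proof (cases "c < pi / 3 \<or> (lam / 20 \<le> norm z \<and> lam / 20 \<le> norm z')")
    case True
    have "c * cot c * (norm x)\<^sup>2 + c * \<bar>u\<bar> \<le> (lam / 2)\<^sup>2"
      if xu: "(x, u) \<in> A_pert lam f" "\<bar>u - f x\<bar> \<le> lam\<^sup>2 / (2 * pi)" and or: "c < pi / 3 \<or> lam / 20 \<le> norm x" for x u
    proof (cases "lam / 20 \<le> norm x")
      case True
      then show ?thesis using A_pert_half_bound[OF lam xu(1) supp] c by simp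
    next
      case False
      then show ?thesis
        using or c by (intro A_pert_half_bound_near_axis[OF lam xu(2) lip C supp]) auto
    qed
    then show ?thesis using True p q ht ht' c by (intro diameter_bound_of_half_bounds) auto
  next
    case False
    define w where "w = z' - z"
    \<comment> \<open>The form vanishes on the diagonal, so one of the points can be replaced by
      \<open>w\<close>, keeping as the other factor a point within \<open>lam / 20\<close> of the
      axis.\<close>
    have im: "\<bar>im_form z z'\<bar> \<le> lam / 20 * norm w"
    proof (cases "norm z < lam / 20")
      case True
      have "im_form z z' = im_form z w" by (simp add: w_def im_form_simps)
      then have "\<bar>im_form z z'\<bar> \<le> norm z * norm w" using abs_im_form_le[of z w] by simp
      also have "\<dots> \<le> lam / 20 * norm w" using True by (intro mult_right_mono) auto
      finally show ?thesis .
    next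
      case nz: False
      have "im_form z z' = - im_form w z'" by (simp add: w_def im_form_simps)
      then have "\<bar>im_form z z'\<bar> \<le> norm w * norm z'" using abs_im_form_le[of w z'] by simp
      also have "\<dots> \<le> norm w * (lam / 20)" using nz False by (intro mult_left_mono) auto
      finally show ?thesis by (simp add: mult.commute)
    qed
    have "\<bar>f z' - f z\<bar> \<le> C * norm w" using lipschitz_onD[OF lip, of z' z] by (simp add: w_def dist_norm)
    also have "\<dots> \<le> 4 * lam / 80 * norm w"
    proof (rule mult_right_mono)
      have "pi * lam / 80 \<le> 4 * lam / 80" using pi_less_4 lam by (intro divide_right_mono mult_right_mono) auto
      then show "C \<le> 4 * lam / 80" using C by linarith
    qed simp
    finally have "\<bar>f z' - f z\<bar> \<le> lam / 20 * norm w" by simp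
    \<comment> \<open>Three equal shares, one from \<open>f\<close> and two from the doubled form;
      with \<open>\<mu> = lam / 2\<close> they add up to the admissible
      \<open>3 / 10 * \<mu> * norm w\<close>.\<close>
    then have "\<bar>t' - t - 2 * im_form z z'\<bar> \<le> lam\<^sup>2 / (2 * pi) + lam\<^sup>2 / (2 * pi) + 3 * (lam / 20 * norm w)"
      using ht ht' im by linarith
    also have "\<dots> = 4 * (lam / 2)\<^sup>2 / pi + 3 / 10 * (lam / 2) * norm w"
      by (simp add: power_divide)
    finally show ?thesis
      using c False lam unfolding w_def[symmetric] by (intro diameter_bound_near_axis) auto
  qed
  have "k * cot k * (norm (z' - z))\<^sup>2 + k * \<bar>t' - t - 2 * im_form z z'\<bar> \<le> lam\<^sup>2" if k: "0 < k" "k < pi" for k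
    using main[of "k / 2"] k by (simp add: power_divide)
  then show ?thesis by (auto simp: cc_region_def)
qed

lemma cc_diam_A_pert:
  fixes f :: "complex ^ 'n::finite \<Rightarrow> real"
  assumes lam: "0 < lam" and lip: "C-lipschitz_on UNIV f" and C: "C \<le> pi * lam / 80"
    and supp: "\<And>z. lam / 20 \<le> norm z \<Longrightarrow> f z = 0"
  shows "cc_diam (A_pert lam f) = ennreal lam"
proof (rule antisym)
  show "cc_diam (A_pert lam f) \<le> ennreal lam"
    unfolding cc_diam_def
  proof (intro SUP_least)
    fix p q assume "p \<in> A_pert lam f" "q \<in> A_pert lam f"
    then have "heis_diff p q \<in> cc_region lam"
      using A_pert_pair_in_cc_region[OF lam lip C supp, of "fst p" "snd p" "fst q" "snd q"]
      by (simp add: heis_diff_def)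
    then show "cc_dist p q \<le> ennreal lam" using cc_dist_le_iff_cc_region[of lam p q] lam by simp
  qed
next
  obtain v :: "complex ^ 'n" where v: "norm v = lam / 2"
    using vector_choose_size[of "lam / 2"] lam by auto
  have mem: "(x, 0) \<in> A_pert lam f" if x: "norm x = lam / 2" for x :: "complex ^ 'n"
  proof -
    have "(x, 0) \<in> cc_region (lam / 2)"
      using lam x by (subst cc_region_iff_profile[where \<phi> = 0]) (auto simp: rho_def g_fun_def)
    moreover have "lam / pi \<le> norm x" unfolding x using lam pi_ge_two by (intro divide_left_mono) auto
    ultimately show ?thesis using lam by (simp add: A_pert_def mem_A2_set_iff)
  qed
  \<comment> \<open>Antipodal points on the equator already realise the diameter, since the distance
    is at least that of the projections.\<close>
  have "ennreal lam \<le> cc_dist (- v, 0) (v, 0)"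
  proof (rule ccontr)
    assume "\<not> ?thesis"
    then have lt: "cc_dist (- v, 0) (v, 0) < ennreal lam" by simp
    then obtain L where L: "cc_dist (- v, 0) (v, 0) = ennreal L" "0 \<le> L"
      by (cases "cc_dist (- v, 0) (v, 0)") auto
    then have "heis_diff (- v, 0) (v, 0) \<in> cc_region L" by (intro cc_dist_le_imp_cc_region) auto
    then have "norm (v + v) \<le> L" using L(2) cc_region_fst_le by (auto simp: heis_diff_def)
    moreover have "norm (v + v) = lam" using v by (simp add: scaleR_2[symmetric])
    ultimately show False using lt L by (simp add: ennreal_less_iff)
  qed
  also have "\<dots> \<le> cc_diam (A_pert lam f)"
    unfolding cc_diam_def using mem[of "- v"] mem[of v] v by (auto intro!: SUP_upper2[of "(- v, 0)"] SUP_upper)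
  finally show "ennreal lam \<le> cc_diam (A_pert lam f)" .
qed

theorem proposition4p5:
  "\<exists>r::real. 0 < r \<and> r < 1 / pi \<and>
     (\<forall>lam::real. \<forall>f :: complex ^ 'n::finite \<Rightarrow> real.
        0 < lam \<longrightarrow>
        (\<exists>C. C-lipschitz_on UNIV f) \<longrightarrow>
        compact (closure {z. f z \<noteq> 0}) \<longrightarrow>
        closure {z. f z \<noteq> 0} \<subseteq> {z. norm z < lam * r} \<longrightarrow>
        Lip f < pi * lam * r / 4 \<longrightarrow>
        emeasure lebesgue (A_pert lam f) = emeasure lebesgue (A_set lam :: 'n heis set) \<and>
        cc_diam (A_pert lam f) = cc_diam (A_set lam :: 'n heis set))"
proof (intro exI[of _ "1 / 20 :: real"] conjI allI impI)
  show "1 / 20 < 1 / pi" using pi_less_4 by (simp add: field_simps)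
  fix lam :: real and f :: "complex ^ 'n \<Rightarrow> real"
  assume lam: "0 < lam" and ex: "\<exists>C. C-lipschitz_on UNIV f"
    and cl: "closure {z. f z \<noteq> 0} \<subseteq> {z. norm z < lam * (1 / 20)}"
    and Lip: "Lip f < pi * lam * (1 / 20) / 4"
  \<comment> \<open>\<open>Lip f\<close> is an infimum, so a genuine Lipschitz constant below
    \<open>pi * lam / 80\<close> is extracted from the strict inequality.\<close>
  have "\<exists>C\<in>{C. C-lipschitz_on UNIV f}. C < pi * lam * (1 / 20) / 4"
    using ex Lip unfolding Lip_def by (intro cInf_lessD) auto
  then obtain C where C: "C-lipschitz_on UNIV f" "C < pi * lam * (1 / 20) / 4"
    by blast
  have supp: "f z = 0" if "lam / 20 \<le> norm z" for z
    using that cl closure_subset[of "{z. f z \<noteq> 0}"] by fastforce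
  have pi20: "lam / 20 \<le> lam / pi" using lam pi_less_4 by (intro divide_left_mono) auto
  have cont: "continuous_on UNIV f" using C(1) by (rule lipschitz_on_continuous_on)
  show "emeasure lebesgue (A_pert lam f) = emeasure lebesgue (A_set lam :: 'n heis set)"
    unfolding A_set_eq_A_pert_0[OF lam]
    by (rule emeasure_A_pert[OF lam cont]) (rule supp[OF order_trans[OF pi20]])
  have "cc_diam (A_pert lam f) = ennreal lam"
    using C supp by (intro cc_diam_A_pert[OF lam C(1)]) auto
  moreover have "cc_diam (A_pert lam (\<lambda>_. 0) :: 'n heis set) = ennreal lam"
    using lam by (intro cc_diam_A_pert[of lam 0]) (auto simp: lipschitz_on_def)
  ultimately show "cc_diam (A_pert lam f) = cc_diam (A_set lam :: 'n heis set)"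
    unfolding A_set_eq_A_pert_0[OF lam] by simp
qed simp

end
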